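(* Any irreducible hypertree has a planar realization. That is, if $\Gamma=\{\Gamma_1,\ldots,\Gamma_d\}$ is an irreducible hypertree on $\{1,\ldots,n\}$, then there exist distinct points $p_1,\ldots,p_n\in\mathbb{P}^2$ such that, for any subset $S\subset\{1,\ldots,n\}$ with at least three elements, the points $\{p_i\}_{i\in S}$ are collinear if and only if $S\subset\Gamma_j$ for some $j$.
   Context: We work over an algebraically closed field $k$ ($\mathbb{P}^2=\mathbb{P}^2_k$). Hypertree: a hypertree $\Gamma=\{\Gamma_1,\ldots,\Gamma_d\}$ on a finite set $N$ is a collection of subsets of $N$ such that (1) $|\Gamma_j|\ge 3$ for every $j$; (2) every $i\in N$ is contained in at least two of the $\Gamma_j$; (3) (convexity) $\bigl|\bigcup_{j\in S}\Gamma_j\bigr|-2\ge\sum_{j\in S}(|\Gamma_j|-2)$ for every non-empty $S\subset\{1,\ldots,d\}$; (4) (normalization) $|N|-2=\sum_{j=1}^d(|\Gamma_j|-2)$. It is irreducible if the inequality in (3) is strict whenever $1<|S|<d$. *)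

theory Defs
  imports "HOL-Analysis.Analysis" "HOL-Computational_Algebra.Polynomial"
begin

text \<open>
  A hypertree with \<open>d\<close> hyperedges on \<open>N\<close> is given as an indexed family \<open>\<Gamma> 1, \<dots>, \<Gamma> d\<close>;
  values of \<open>\<Gamma>\<close> outside \<open>{1..d}\<close> are irrelevant. Cardinalities are cast to \<^typ>\<open>int\<close>
  to avoid truncated subtraction.
\<close>

definition hypertree :: "'a set \<Rightarrow> nat \<Rightarrow> (nat \<Rightarrow> 'a set) \<Rightarrow> bool" where
  "hypertree N d \<Gamma> \<longleftrightarrow>
     finite N \<and>
     (\<forall>j\<in>{1..d}. \<Gamma> j \<subseteq> N) \<and>
     (\<forall>j\<in>{1..d}. card (\<Gamma> j) \<ge> 3) \<and>
     (\<forall>i\<in>N. card {j\<in>{1..d}. i \<in> \<Gamma> j} \<ge> 2) \<and>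
     (\<forall>S. S \<noteq> {} \<and> S \<subseteq> {1..d} \<longrightarrow>
        int (card (\<Union>j\<in>S. \<Gamma> j)) - 2 \<ge> (\<Sum>j\<in>S. (int (card (\<Gamma> j)) - 2))) \<and>
     int (card N) - 2 = (\<Sum>j=1..d. (int (card (\<Gamma> j)) - 2))"

definition irreducible_hypertree :: "'a set \<Rightarrow> nat \<Rightarrow> (nat \<Rightarrow> 'a set) \<Rightarrow> bool" where
  "irreducible_hypertree N d \<Gamma> \<longleftrightarrow>
     hypertree N d \<Gamma> \<and>
     (\<forall>S. S \<subseteq> {1..d} \<and> 1 < card S \<and> card S < d \<longrightarrow>
        int (card (\<Union>j\<in>S. \<Gamma> j)) - 2 > (\<Sum>j\<in>S. (int (card (\<Gamma> j)) - 2)))"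

text \<open>
  The projective plane over a field \<open>k\<close>: its points are the one-dimensional linear subspaces
  of \<open>k\<^sup>3\<close>, its lines the two-dimensional ones, and incidence is inclusion.
\<close>

definition proj_plane :: "('k::field ^ 3) set set" where
  "proj_plane = {P. vec.subspace P \<and> vec.dim P = 1}"

definition proj_lines :: "('k::field ^ 3) set set" where
  "proj_lines = {L. vec.subspace L \<and> vec.dim L = 2}"

definition proj_collinear :: "('k::field ^ 3) set set \<Rightarrow> bool" where
  "proj_collinear A \<longleftrightarrow> (\<exists>L\<in>proj_lines. \<forall>P\<in>A. P \<subseteq> L)"

definition planar_realization ::
  "'a set \<Rightarrow> nat \<Rightarrow> (nat \<Rightarrow> 'a set) \<Rightarrow> ('a \<Rightarrow> ('k::field ^ 3) set) \<Rightarrow> bool" where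
  "planar_realization N d \<Gamma> p \<longleftrightarrow>
     (\<forall>i\<in>N. p i \<in> proj_plane) \<and>
     inj_on p N \<and>
     (\<forall>S. S \<subseteq> N \<and> card S \<ge> 3 \<longrightarrow>
        (proj_collinear (p ` S) \<longleftrightarrow> (\<exists>j\<in>{1..d}. S \<subseteq> \<Gamma> j)))"

end

theory Submission
  imports Defs
begin

text \<open>
  Put one edge \<open>E\<close> on the vertical line \<open>x = 0\<close>, choose the other abscissas generically, and look for
  heights \<open>y\<close> such that the points of every other edge lie on a line \<open>y = a x + b\<close>. This is a linear
  system in \<open>(y, a, b)\<close>, and what has to be shown is that its equations, together with those of one
  extra line through a triple \<open>T\<close> contained in no edge, are independent: then some solution violates
  the collinearity of \<open>T\<close>, and a generic solution violates all of them at once.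

  Suppose that a minimal dependency (a stress) \<open>w\<close> persists for generic \<open>x\<close>. Its first-order variation in the
  abscissa of a point outside \<open>E\<close> shows that for every solution the stress scaled by the slopes,
  \<open>a w\<close>, cancels at every point outside \<open>E\<close>. As \<open>x = 0\<close> on \<open>E\<close>, the stress scaled by the intercepts
  \<open>b = y - a x\<close> is then again a dependency, hence proportional to \<open>w\<close>. So all lines of the stress have the same
  intercept, and lines that share a point outside \<open>E\<close> also have the same slope. The
  convexity inequalities leave too many unknowns for such a rigid solution space.
\<close>

subsection \<open>Independent rows of a matrix\<close>

text \<open>Independence is that of an indexed family: equal rows with different indices count as
  dependent.\<close>

definition indep_rows :: "('q \<Rightarrow> 'c \<Rightarrow> 'k::field) \<Rightarrow> 'q set \<Rightarrow> 'c set \<Rightarrow> bool" where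
  "indep_rows f Q C \<longleftrightarrow> (\<forall>w. (\<forall>c\<in>C. (\<Sum>q\<in>Q. w q * f q c) = 0) \<longrightarrow> (\<forall>q\<in>Q. w q = 0))"

lemma indep_rowsD:
  "indep_rows f Q C \<Longrightarrow> (\<And>c. c \<in> C \<Longrightarrow> (\<Sum>q\<in>Q. w q * f q c) = 0) \<Longrightarrow> q \<in> Q \<Longrightarrow> w q = 0"
  unfolding indep_rows_def by blast

lemma indep_rowsI:
  "(\<And>w q. (\<And>c. c \<in> C \<Longrightarrow> (\<Sum>q\<in>Q. w q * f q c) = 0) \<Longrightarrow> q \<in> Q \<Longrightarrow> w q = 0) \<Longrightarrow> indep_rows f Q C"
  unfolding indep_rows_def by blast

lemma indep_rows_empty [simp]: "indep_rows f {} C"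
  unfolding indep_rows_def by simp

lemma indep_rows_nonzero:
  assumes "indep_rows f Q C" "finite Q" "q0 \<in> Q"
  shows "\<exists>c\<in>C. f q0 c \<noteq> 0"
proof (rule ccontr)
  assume "\<not> ?thesis"
  then have z: "f q0 c = 0" if "c \<in> C" for c using that by blast
  have "(if q0 = q0 then 1 else (0::'c)) = 0"
  proof (rule indep_rowsD[OF assms(1) _ assms(3), of "\<lambda>q. if q = q0 then 1 else 0"])
    fix c assume "c \<in> C"
    have "(\<Sum>q\<in>Q. (if q = q0 then 1 else 0) * f q c) = (\<Sum>q\<in>Q. if q = q0 then f q c else 0)"
      by (intro sum.cong) auto
    also have "\<dots> = 0" using assms(2,3) z[OF \<open>c \<in> C\<close>] by simp
    finally show "(\<Sum>q\<in>Q. (if q = q0 then 1 else 0) * f q c) = 0" .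
  qed
  then show False by simp
qed

text \<open>One step of Gaussian elimination with pivot \<open>f q0 c0\<close>. Entries are
  cross-multiplied rather than divided, so the same step works on polynomial entries.\<close>

lemma indep_rows_eliminate:
  fixes f :: "'q \<Rightarrow> 'c \<Rightarrow> 'k::field"
  assumes Q: "finite Q" "q0 \<notin> Q" and c0: "c0 \<in> C" "f q0 c0 \<noteq> 0"
  shows "indep_rows f (insert q0 Q) C \<longleftrightarrow>
    indep_rows (\<lambda>q c. f q c * f q0 c0 - f q c0 * f q0 c) Q C" (is "?L \<longleftrightarrow> ?R")
proof
  assume L: ?L
  show ?R
  proof (rule indep_rowsI)
    fix w q assume w: "\<And>c. c \<in> C \<Longrightarrow> (\<Sum>q\<in>Q. w q * (f q c * f q0 c0 - f q c0 * f q0 c)) = 0" and q: "q \<in> Q"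
    \<comment> \<open>The coefficient of the pivot row collects what the reduced rows subtract; the
      other coefficients are scaled by the pivot.\<close>
    define w' where "w' = (\<lambda>q. if q = q0 then - (\<Sum>q\<in>Q. w q * f q c0) else w q * f q0 c0)"
    have "w' q = 0"
    proof (rule indep_rowsD[OF L])
      fix c assume "c \<in> C"
      have "(\<Sum>q\<in>insert q0 Q. w' q * f q c) = w' q0 * f q0 c + (\<Sum>q\<in>Q. w' q * f q c)"
        using Q by simp
      also have "(\<Sum>q\<in>Q. w' q * f q c) = (\<Sum>q\<in>Q. w q * f q0 c0 * f q c)"
        using Q by (intro sum.cong) (auto simp: w'_def)
      also have "w' q0 * f q0 c + \<dots> = (\<Sum>q\<in>Q. w q * (f q c * f q0 c0 - f q c0 * f q0 c))"
        by (simp add: w'_def algebra_simps sum_subtractf sum_distrib_left)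
      finally show "(\<Sum>q\<in>insert q0 Q. w' q * f q c) = 0" using w[OF \<open>c \<in> C\<close>] by simp
    qed (use q in simp)
    then show "w q = 0" using q Q c0 by (auto simp: w'_def split: if_splits)
  qed
next
  assume R: ?R
  show ?L
  proof (rule indep_rowsI)
    fix w q assume w: "\<And>c. c \<in> C \<Longrightarrow> (\<Sum>q\<in>insert q0 Q. w q * f q c) = 0" and q: "q \<in> insert q0 Q"
    have s: "(\<Sum>q\<in>Q. w q * f q c) = - (w q0 * f q0 c)" if "c \<in> C" for c
      using w[OF that] Q by (simp add: add_eq_0_iff)
    have z: "w q = 0" if "q \<in> Q" for q
    proof (rule indep_rowsD[OF R _ that])
      fix c assume "c \<in> C"
      have "(\<Sum>q\<in>Q. w q * (f q c * f q0 c0 - f q c0 * f q0 c))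
          = f q0 c0 * (\<Sum>q\<in>Q. w q * f q c) - f q0 c * (\<Sum>q\<in>Q. w q * f q c0)"
        by (simp add: algebra_simps sum_subtractf sum_distrib_left)
      then show "(\<Sum>q\<in>Q. w q * (f q c * f q0 c0 - f q c0 * f q0 c)) = 0"
        by (simp add: s[OF \<open>c \<in> C\<close>] s[OF c0(1)])
    qed
    moreover have "w q0 = 0" using s[OF c0(1)] c0(2) z by simp
    ultimately show "w q = 0" using q by auto
  qed
qed

text \<open>Where the pivot polynomial does not vanish, dependence passes to the reduced matrix,
  which has one row fewer. The pivot is nonzero at \<open>s\<close>, so it has only finitely many
  roots.\<close>

lemma finite_dependent_specializations:
  fixes f :: "'q \<Rightarrow> 'c \<Rightarrow> 'k::field poly"
  assumes "finite Q" "indep_rows (\<lambda>q c. poly (f q c) s) Q C"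
  shows "finite {t. \<not> indep_rows (\<lambda>q c. poly (f q c) t) Q C}"
  using assms
proof (induction Q arbitrary: f rule: finite_induct)
  case empty
  then show ?case by simp
next
  case (insert q0 Q)
  obtain c0 where c0: "c0 \<in> C" "poly (f q0 c0) s \<noteq> 0"
    using indep_rows_nonzero[OF insert.prems, of q0] insert.hyps by auto
  define g where "g = (\<lambda>q c. f q c * f q0 c0 - f q c0 * f q0 c)"
  have "indep_rows (\<lambda>q c. poly (g q c) s) Q C"
    using indep_rows_eliminate[OF insert.hyps c0(1), of "\<lambda>q c. poly (f q c) s"] c0(2) insert.prems
    by (simp add: g_def)
  then have "finite {t. \<not> indep_rows (\<lambda>q c. poly (g q c) t) Q C}" by (rule insert.IH)
  moreover have "finite {t. poly (f q0 c0) t = 0}"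
    using c0(2) by (intro poly_roots_finite) auto
  moreover have "{t. \<not> indep_rows (\<lambda>q c. poly (f q c) t) (insert q0 Q) C} \<subseteq>
      {t. \<not> indep_rows (\<lambda>q c. poly (g q c) t) Q C} \<union> {t. poly (f q0 c0) t = 0}"
    using indep_rows_eliminate[OF insert.hyps c0(1), of "\<lambda>q c. poly (f q c) t" for t]
    by (auto simp: g_def)
  ultimately show ?case by (meson finite_UnI finite_subset)
qed

text \<open>The value \<open>t = 0\<close> gives back \<open>f\<close>. Moving one abscissa changes
  the incidence matrix along exactly such a pencil.\<close>

lemma finite_dependent_pencil:
  fixes f g :: "'q \<Rightarrow> 'c \<Rightarrow> 'k::field"
  assumes "finite Q" "indep_rows f Q C"
  shows "finite {t. \<not> indep_rows (\<lambda>q c. f q c + t * g q c) Q C}"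
  using finite_dependent_specializations[OF assms(1), of "\<lambda>q c. [:f q c, g q c:]" 0 C] assms(2)
  by simp

text \<open>The reduced system is solved first, then the coordinate \<open>c0\<close> is adjusted
  until the pivot equation holds. The reduced right-hand sides are chosen so that this adjustment
  makes the other equations true as well.\<close>

lemma indep_rows_solvable:
  fixes f :: "'q \<Rightarrow> 'c \<Rightarrow> 'k::field"
  assumes "finite Q" "finite C" "indep_rows f Q C"
  shows "\<exists>v. \<forall>q\<in>Q. (\<Sum>c\<in>C. f q c * v c) = \<beta> q"
  using assms(1,3)
proof (induction Q arbitrary: f \<beta> rule: finite_induct)
  case empty
  then show ?case by simp
next
  case (insert q0 Q)
  obtain c0 where c0: "c0 \<in> C" "f q0 c0 \<noteq> 0"
    using indep_rows_nonzero[OF insert.prems, of q0] insert.hyps by auto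
  define g where "g = (\<lambda>q c. f q c * f q0 c0 - f q c0 * f q0 c)"
  have "indep_rows g Q C"
    using indep_rows_eliminate[OF insert.hyps c0(1), of f] c0(2) insert.prems by (simp add: g_def)
  then obtain v where v: "\<And>q. q \<in> Q \<Longrightarrow> (\<Sum>c\<in>C. g q c * v c) = \<beta> q * f q0 c0 - f q c0 * \<beta> q0"
    using insert.IH[of g "\<lambda>q. \<beta> q * f q0 c0 - f q c0 * \<beta> q0"] by blast
  define s where "s = (\<beta> q0 - (\<Sum>c\<in>C. f q0 c * v c)) / f q0 c0"
  define v' where "v' = (\<lambda>c. v c + (if c = c0 then s else 0))"
  have v': "(\<Sum>c\<in>C. f q c * v' c) = (\<Sum>c\<in>C. f q c * v c) + f q c0 * s" for q
    using assms(2) c0(1) by (simp add: v'_def distrib_left sum.distrib if_distrib[of "\<lambda>z. _ * z"] cong: if_cong)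
  have s: "f q0 c0 * s = \<beta> q0 - (\<Sum>c\<in>C. f q0 c * v c)" using c0(2) by (simp add: s_def)
  have "(\<Sum>c\<in>C. f q c * v' c) = \<beta> q" if "q \<in> Q" for q
  proof -
    have "f q0 c0 * (\<Sum>c\<in>C. f q c * v c) = (\<Sum>c\<in>C. g q c * v c) + f q c0 * (\<Sum>c\<in>C. f q0 c * v c)"
      by (simp add: g_def algebra_simps sum_subtractf sum_distrib_left)
    also have "\<dots> = \<beta> q * f q0 c0 - f q c0 * (f q0 c0 * s)"
      unfolding v[OF that] s by (simp add: algebra_simps)
    finally have e: "f q0 c0 * (\<Sum>c\<in>C. f q c * v c) = \<beta> q * f q0 c0 - f q c0 * (f q0 c0 * s)" .
    have "f q0 c0 * (\<Sum>c\<in>C. f q c * v' c) = f q0 c0 * \<beta> q"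
      unfolding v' distrib_left e by (simp add: mult_ac)
    then show ?thesis using c0(2) by simp
  qed
  moreover have "(\<Sum>c\<in>C. f q0 c * v' c) = \<beta> q0" by (simp add: v' s)
  ultimately show ?case by (intro exI[of _ v']) auto
qed

text \<open>Each equation with a pivot eliminates one unknown, and a zero equation is dropped, so
  the surplus of unknowns survives the induction.\<close>

lemma underdetermined_solution:
  fixes f :: "'q \<Rightarrow> 'c \<Rightarrow> 'k::field"
  assumes "finite Q" "finite C" "card Q < card C"
  shows "\<exists>v. (\<exists>c\<in>C. v c \<noteq> 0) \<and> (\<forall>q\<in>Q. (\<Sum>c\<in>C. f q c * v c) = 0)"
  using assms
proof (induction Q arbitrary: f C rule: finite_induct)
  case empty
  then show ?case by (intro exI[of _ "\<lambda>_. 1"]) (auto simp: card_gt_0_iff)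
next
  case (insert q0 Q)
  show ?case
  proof (cases "\<forall>c\<in>C. f q0 c = 0")
    case True
    have "card Q < card C" using insert.prems insert.hyps by simp
    then obtain v where "\<exists>c\<in>C. v c \<noteq> 0" "\<forall>q\<in>Q. (\<Sum>c\<in>C. f q c * v c) = 0"
      using insert.IH[of C f] insert.prems by blast
    then show ?thesis using True by (intro exI[of _ v]) auto
  next
    case False
    then obtain c0 where c0: "c0 \<in> C" "f q0 c0 \<noteq> 0" by blast
    have "card Q < card (C - {c0})" using insert.prems insert.hyps c0 by simp
    then obtain v where v: "\<exists>c\<in>C - {c0}. v c \<noteq> 0"
        "\<And>q. q \<in> Q \<Longrightarrow> (\<Sum>c\<in>C - {c0}. (f q c - f q c0 * f q0 c / f q0 c0) * v c) = 0"
      using insert.IH[of "C - {c0}" "\<lambda>q c. f q c - f q c0 * f q0 c / f q0 c0"] insert.prems by blast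
    define s where "s = - (\<Sum>c\<in>C - {c0}. f q0 c * v c) / f q0 c0"
    define v' where "v' = v(c0 := s)"
    have v': "(\<Sum>c\<in>C. f q c * v' c) = f q c0 * s + (\<Sum>c\<in>C - {c0}. f q c * v c)" for q
      using insert.prems(1) c0(1) by (subst sum.remove[of _ c0]) (auto simp: v'_def intro!: sum.cong)
    have "(\<Sum>c\<in>C. f q c * v' c) = 0" if "q \<in> Q" for q
    proof -
      have "(\<Sum>c\<in>C - {c0}. f q c0 * f q0 c / f q0 c0 * v c) = - (f q c0 * s)"
        by (simp add: s_def sum_distrib_left sum_divide_distrib mult.assoc)
      then show ?thesis using v(2)[OF that] by (simp add: v' left_diff_distrib sum_subtractf add.commute)
    qed
    moreover have "(\<Sum>c\<in>C. f q0 c * v' c) = 0" using c0(2) by (simp add: v' s_def)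
    moreover have "\<exists>c\<in>C. v' c \<noteq> 0" using v(1) by (auto simp: v'_def)
    ultimately show ?thesis by (intro exI[of _ v']) auto
  qed
qed

text \<open>Over a finite field, the product of all \<open>X - a\<close> plus 1 is a nonconstant
  polynomial without roots.\<close>

lemma infinite_alg_closed_field: "infinite (UNIV :: 'k::alg_closed_field set)"
proof
  assume fin: "finite (UNIV :: 'k set)"
  define p :: "'k poly" where "p = (\<Prod>a\<in>UNIV. [:-a, 1:])"
  have deg: "degree p = card (UNIV :: 'k set)"
    unfolding p_def by (subst degree_prod_eq_sum_degree) auto
  have "card (UNIV :: 'k set) > 0" using fin by (simp add: finite_UNIV_card_ge_0)
  then have "degree (p + 1) > 0" using deg by (simp add: degree_add_eq_left)
  then obtain z where "poly (p + 1) z = 0" using alg_closed_imp_poly_has_root by blast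
  moreover have "poly p z = 0" using fin by (auto simp: p_def poly_prod)
  ultimately show False by simp
qed

subsection \<open>Counting in irreducible hypertrees\<close>

text \<open>The edges form a set instead of a family. The 2 of the convexity inequality is moved to
  the other side, so that strictness over the integers reads \<open>+ 3\<close>. \<open>E\<close> is
  the edge to be placed on the line \<open>x = 0\<close>.\<close>

locale irreducible_edges =
  fixes N :: "'a set" and G :: "'a set set" and E :: "'a set"
  assumes finite_N: "finite N"
    and edge_subset: "A \<in> G \<Longrightarrow> A \<subseteq> N"
    and card_edge: "A \<in> G \<Longrightarrow> 3 \<le> card A"
    and degree_ge_2: "i \<in> N \<Longrightarrow> 2 \<le> card {A\<in>G. i \<in> A}"
    and convex: "S \<subseteq> G \<Longrightarrow> S \<noteq> {} \<Longrightarrow> (\<Sum>A\<in>S. int (card A) - 2) + 2 \<le> int (card (\<Union>S))"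
    and strict_convex: "S \<subseteq> G \<Longrightarrow> 1 < card S \<Longrightarrow> card S < card G \<Longrightarrow>
      (\<Sum>A\<in>S. int (card A) - 2) + 3 \<le> int (card (\<Union>S))"
    and normalized: "int (card N) = (\<Sum>A\<in>G. int (card A) - 2) + 2"
    and E_edge: "E \<in> G"
    and card_edges: "2 < card G"
begin

lemma finite_G: "finite G"
  by (meson finite_N edge_subset finite_Pow_iff finite_subset Pow_iff subsetI)

lemma finite_edge: "A \<in> G \<Longrightarrow> finite A"
  using edge_subset finite_N finite_subset by blast

text \<open>As there are more than two edges, strict convexity applies to the pair and gives
  \<open>|A \<union> B| \<ge> |A| + |B| - 1\<close>.\<close>

lemma card_Int_edges:
  assumes "A \<in> G" "B \<in> G" "A \<noteq> B"
  shows "card (A \<inter> B) \<le> 1"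
proof -
  have "(\<Sum>A\<in>{A, B}. int (card A) - 2) + 3 \<le> int (card (\<Union>{A, B}))"
    using assms card_edges by (intro strict_convex) auto
  then show ?thesis
    using assms card_Un_Int[OF finite_edge[OF assms(1)] finite_edge[OF assms(2)]] by simp
qed

abbreviation J :: "'a set set" where "J \<equiv> G - {E}"

lemma card_J: "card J = card G - 1"
  using finite_G E_edge by simp

lemma card_N_minus_E: "int (card (N - E)) = (\<Sum>A\<in>J. int (card A) - 2)"
proof -
  have "int (card N) = int (card (N - E)) + int (card E)"
    using card_Diff_subset[OF finite_edge[OF E_edge] edge_subset[OF E_edge]]
      card_mono[OF finite_N edge_subset[OF E_edge]] by simp
  then show ?thesis
    using normalized sum.remove[OF finite_G E_edge, of "\<lambda>A. int (card A) - 2"] by simp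
qed

text \<open>Strict convexity is applied to \<open>insert E K\<close>, a proper subfamily of
  \<open>G\<close>; the contribution of \<open>E\<close> then cancels up to the constant 2.\<close>

lemma card_outside_E:
  assumes "K \<subset> J" "K \<noteq> {}"
  shows "(\<Sum>A\<in>K. int (card A) - 2) + 1 \<le> int (card (\<Union>K - E))"
proof -
  have fK: "finite K" using assms finite_G finite_subset by blast
  have EK: "E \<notin> K" using assms by blast
  have "card K < card J" using assms finite_G by (intro psubset_card_mono) auto
  then have "card (insert E K) < card G" using card_J fK EK by simp
  moreover have "1 < card (insert E K)" using fK EK assms(2) by (simp add: card_gt_0_iff)
  ultimately have "(\<Sum>A\<in>insert E K. int (card A) - 2) + 3 \<le> int (card (\<Union>(insert E K)))"
    using assms E_edge by (intro strict_convex) auto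
  moreover have "card (\<Union>(insert E K)) = card E + card (\<Union>K - E)"
  proof -
    have "\<Union>(insert E K) = E \<union> (\<Union>K - E)" by blast
    moreover have "finite (\<Union>K)" using assms edge_subset finite_N fK finite_edge by blast
    ultimately show ?thesis
      using card_Un_disjoint[of E "\<Union>K - E"] finite_edge[OF E_edge] by auto
  qed
  ultimately show ?thesis using fK EK by simp
qed

end

section \<open>Excess of families of shrunken edges\<close>

text \<open>Removing one point from one edge lowers the sum by 1 and the size of the union by at
  most 1, so the excess \<open>|\<Union>K - D| - \<Sum>(|A| - 2)\<close> cannot drop.\<close>

lemma excess_mono:
  assumes "finite K" "\<And>A. A \<in> K \<Longrightarrow> finite A" "\<And>A. A \<in> K \<Longrightarrow> p A \<subseteq> A"
  shows "int (card (\<Union>K - D)) - (\<Sum>A\<in>K. int (card A) - 2)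
    \<le> int (card ((\<Union>A\<in>K. p A) - D)) - (\<Sum>A\<in>K. int (card (p A)) - 2)"
proof -
  have fp: "finite (p A)" if "A \<in> K" for A using assms that finite_subset by blast
  have "card (\<Union>K - D) \<le> card (((\<Union>A\<in>K. p A) - D) \<union> (\<Union>A\<in>K. A - p A))"
    using assms fp by (intro card_mono) auto
  also have "\<dots> \<le> card ((\<Union>A\<in>K. p A) - D) + card (\<Union>A\<in>K. A - p A)" by (rule card_Un_le)
  also have "card (\<Union>A\<in>K. A - p A) \<le> (\<Sum>A\<in>K. card (A - p A))" by (rule card_UN_le[OF assms(1)])
  finally have "int (card (\<Union>K - D)) \<le> int (card ((\<Union>A\<in>K. p A) - D)) + (\<Sum>A\<in>K. int (card (A - p A)))"
    by (simp flip: of_nat_sum of_nat_add)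
  moreover have "(\<Sum>A\<in>K. int (card (A - p A))) = (\<Sum>A\<in>K. int (card A) - int (card (p A)))"
    using assms fp by (intro sum.cong) (auto simp: card_Diff_subset of_nat_diff card_mono)
  ultimately show ?thesis by (simp add: sum_subtractf)
qed


text \<open>A point that disappears from all edges of \<open>J\<close> was removed at least once if
  it lies on \<open>E\<close>, and at least twice otherwise, by the degree condition. Of these
  removals only one per point outside \<open>E\<close> is paid for by the shrinking union.\<close>

lemma (in irreducible_edges) excess_J_ge:
  assumes p: "\<And>A. A \<in> J \<Longrightarrow> p A \<subseteq> A"
  shows "int (card (N - (\<Union>A\<in>J. p A))) \<le> int (card ((\<Union>A\<in>J. p A) - E)) - (\<Sum>A\<in>J. int (card (p A)) - 2)"
proof -
  define M where "M = N - (\<Union>A\<in>J. p A)"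
  have fJ: "finite J" using finite_G by blast
  have fin: "finite A" "finite (p A)" if "A \<in> J" for A
    using that p finite_edge finite_subset by blast+
  have fM: "finite M" using finite_N by (simp add: M_def)
  have EN: "E \<subseteq> N" using edge_subset E_edge by blast
  have deg: "(1::nat) + (if i \<in> E then 0 else 1) \<le> (\<Sum>A\<in>J. if i \<in> A then 1 else 0)" if "i \<in> N" for i :: 'a
  proof -
    have "{A\<in>G. i \<in> A} \<subseteq> (if i \<in> E then insert E {A\<in>J. i \<in> A} else {A\<in>J. i \<in> A})" by auto
    then have "card {A\<in>G. i \<in> A} \<le> card (if i \<in> E then insert E {A\<in>J. i \<in> A} else {A\<in>J. i \<in> A})"
      using fJ by (intro card_mono) auto
    also have "\<dots> \<le> card {A\<in>J. i \<in> A} + (if i \<in> E then 1 else 0)"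
      using fJ by (auto simp: card_insert_if)
    finally have "2 \<le> card {A\<in>J. i \<in> A} + (if i \<in> E then 1 else 0)"
      using degree_ge_2[OF that] by linarith
    moreover have "(\<Sum>A\<in>J. if i \<in> A then 1 else 0 :: nat) = card {A\<in>J. i \<in> A}"
      using fJ by (simp add: sum.If_cases Int_def conj_commute)
    ultimately show ?thesis by (auto split: if_splits)
  qed
  have "card M + card (M - E) = (\<Sum>i\<in>M. 1 + (if i \<in> E then 0 else 1))"
    unfolding sum.distrib using fM by (simp add: sum.If_cases Diff_eq)
  also have "\<dots> \<le> (\<Sum>i\<in>M. \<Sum>A\<in>J. if i \<in> A then 1 else 0)"
    by (intro sum_mono deg) (auto simp: M_def)
  also have "\<dots> = (\<Sum>A\<in>J. \<Sum>i\<in>M. if i \<in> A then 1 else 0)" by (rule sum.swap)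
  also have "\<dots> \<le> (\<Sum>A\<in>J. card (A - p A))"
  proof (intro sum_mono)
    fix A assume "A \<in> J"
    have "(\<Sum>i\<in>M. if i \<in> A then 1 else 0) = card (M \<inter> A)" using fM by (simp add: sum.If_cases)
    also have "\<dots> \<le> card (A - p A)" using \<open>A \<in> J\<close> fin by (intro card_mono) (auto simp: M_def)
    finally show "(\<Sum>i\<in>M. if i \<in> A then 1 else 0) \<le> card (A - p A)" .
  qed
  finally have 1: "int (card M) + int (card (M - E)) \<le> (\<Sum>A\<in>J. int (card (A - p A)))"
    by (simp flip: of_nat_sum of_nat_add)
  have 2: "(\<Sum>A\<in>J. int (card (A - p A))) = (\<Sum>A\<in>J. int (card A) - 2) - (\<Sum>A\<in>J. int (card (p A)) - 2)"
    unfolding sum_subtractf[symmetric]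
    using fin p by (intro sum.cong) (auto simp: card_Diff_subset of_nat_diff card_mono)
  have "N - E = (M - E) \<union> ((\<Union>A\<in>J. p A) - E)"
    using p edge_subset by (auto simp: M_def)
  then have "card (N - E) \<le> card (M - E) + card ((\<Union>A\<in>J. p A) - E)"
    by (metis card_Un_le)
  then show ?thesis using 1 2 card_N_minus_E unfolding M_def by linarith
qed

text \<open>Adding \<open>T\<close> to a family raises the sum by 1. With one edge this is paid by a
  point of \<open>T\<close> outside that edge, with several edges by strict convexity, which applies
  because \<open>E\<close> is missing from the family.\<close>

lemma (in irreducible_edges) excess_ge_2:
  assumes T: "card T = 3" "\<And>A. A \<in> G \<Longrightarrow> \<not> T \<subseteq> A" "T \<subseteq> N"
    and K: "K \<subseteq> insert T J" "K \<noteq> {}"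
  shows "2 \<le> int (card (\<Union>K)) - (\<Sum>A\<in>K. int (card A) - 2)"
proof (cases "T \<in> K")
  case False
  then have "K \<subseteq> G" using K by auto
  then show ?thesis using convex[of K] K by simp
next
  case True
  define K0 where "K0 = K - {T}"
  have K0: "K0 \<subseteq> J" "K = insert T K0" "T \<notin> K0" using True K by (auto simp: K0_def)
  have f: "finite K0" "finite T"
    using K0(1) finite_G T(1) by (auto intro: finite_subset card_ge_0_finite)
  have fU: "finite (\<Union>K)" using K0 edge_subset T(3) finite_N by (intro finite_subset[of "\<Union>K" N]) auto
  have sum: "(\<Sum>A\<in>K. int (card A) - 2) = 1 + (\<Sum>A\<in>K0. int (card A) - 2)"
    using K0 f T(1) by simp
  consider "K0 = {}" | A where "K0 = {A}" | "1 < card K0"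
    using f by (metis One_nat_def card_1_singletonE card_0_eq less_one linorder_neqE_nat)
  then show ?thesis
  proof cases
    case 1
    then show ?thesis using K0 T(1) by simp
  next
    case (2 A)
    have "A \<subset> \<Union>K" using K0 2 T(2)[of A] by auto
    then have "card A < card (\<Union>K)" using fU by (intro psubset_card_mono)
    then show ?thesis using sum 2 by simp
  next
    case 3
    have "card K0 < card G" using K0(1) E_edge finite_G by (intro psubset_card_mono) auto
    then have "(\<Sum>A\<in>K0. int (card A) - 2) + 3 \<le> int (card (\<Union>K0))"
      using K0(1) 3 by (intro strict_convex) auto
    moreover have "card (\<Union>K0) \<le> card (\<Union>K)" using fU K0 by (intro card_mono) auto
    ultimately show ?thesis using sum by simp
  qed
qed

text \<open>In the application \<open>p A\<close> consists of the points of a stress on the line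
  \<open>A\<close>, and \<open>P\<close> groups the lines connected through points outside
  \<open>E\<close>. The inequality leaves a nonzero solution even after one slope per class and one
  intercept are normalized.\<close>

lemma (in irreducible_edges) excess_gt_card_partition:
  assumes T: "card T = 3" "\<And>A. A \<in> G \<Longrightarrow> \<not> T \<subseteq> A" "T \<subseteq> N"
    and p: "\<And>A. A \<in> S \<Longrightarrow> p A \<subseteq> A"
    and S: "S \<subseteq> insert T J" "S \<noteq> {}"
    and P: "\<Union>P = S" "disjoint P" "{} \<notin> P"
    and sep: "\<And>K L. K \<in> P \<Longrightarrow> L \<in> P \<Longrightarrow> K \<noteq> L \<Longrightarrow>
      ((\<Union>A\<in>K. p A) - E) \<inter> ((\<Union>A\<in>L. p A) - E) = {}"
  shows "int (card P) < int (card (\<Union>A\<in>S. p A)) - (\<Sum>A\<in>S. int (card (p A)) - 2)"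
proof -
  define U where "U = (\<lambda>K. \<Union>A\<in>K. p A)"
  define s where "s = (\<lambda>K. \<Sum>A\<in>K. int (card (p A)) - 2)"
  have fS: "finite S" using S finite_G by (meson finite_Diff finite_insert finite_subset)
  have fP: "finite P" using P(1) fS by (metis finite_UnionD)
  have fA: "finite A" if "A \<in> insert T J" for A
    using that finite_edge T(1) by (auto intro: card_ge_0_finite)
  have fK: "finite K" "K \<subseteq> S" "K \<noteq> {}" if "K \<in> P" for K
    using that fS P by (auto intro: finite_subset)
  have SN: "A \<subseteq> N" if "A \<in> S" for A using that S T(3) edge_subset by auto
  have US: "U S \<subseteq> N" using p SN by (fastforce simp: U_def)
  have fU: "finite (U K)" if "K \<subseteq> S" for K
    using that US finite_N by (auto simp: U_def intro: finite_subset[of _ N])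
  have TJ: "T \<notin> J" using T(2) by auto
  \<comment> \<open>Distinct classes are disjoint outside \<open>E\<close> but may share points of
    \<open>E\<close>; \<open>m\<close> counts these once.\<close>
  define m where "m = card (U S \<inter> E)"
  have total: "int (card (U S)) - s S = (\<Sum>K\<in>P. int (card (U K - E)) - s K) + int m"
  proof -
    have "card (U S) = card (U S - E) + m"
      unfolding m_def using fU[of S] by (subst card_Un_disjoint[symmetric]) (auto intro!: arg_cong[of _ _ card])
    moreover have "U S - E = (\<Union>K\<in>P. U K - E)" using P(1) by (auto simp: U_def)
    moreover have "card (\<Union>K\<in>P. U K - E) = (\<Sum>K\<in>P. card (U K - E))"
    proof (intro card_UN_disjoint fP ballI impI)
      show "finite (U K - E)" if "K \<in> P" for K using fU fK[OF that] by blast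
    qed (use sep in \<open>auto simp: U_def\<close>)
    moreover have "s S = (\<Sum>K\<in>P. s K)"
      unfolding s_def P(1)[symmetric]
      using fK P(2) by (subst sum.Union_disjoint) (auto simp: disjoint_def)
    ultimately show ?thesis by (simp add: sum_subtractf)
  qed
  have mono: "int (card (\<Union>K - D)) - (\<Sum>A\<in>K. int (card A) - 2) \<le> int (card (U K - D)) - s K"
    if "K \<subseteq> S" for K D
    unfolding U_def s_def
  proof (rule excess_mono)
    show "finite K" using finite_subset[OF that fS] .
    show "finite A" "p A \<subseteq> A" if "A \<in> K" for A using that \<open>K \<subseteq> S\<close> S(1) p by (auto intro!: fA)
  qed
  have ge2: "2 \<le> int (card (U K)) - s K" if "K \<subseteq> S" "K \<noteq> {}" for K
    using excess_ge_2[OF T order.trans[OF that(1) S(1)] that(2)] mono[OF that(1), of "{}"] by simp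
  consider (one) "P = {S}" | (J) "J \<in> P" "P \<noteq> {S}" | (small) "P \<noteq> {S}" "J \<notin> P" by blast
  then have "int (card P) < int (card (U S)) - s S"
  proof cases
    case one
    then show ?thesis using ge2[of S] S(2) by simp
  next
    \<comment> \<open>The only other class is \<open>{T}\<close>. The points of \<open>E\<close>
      missed by \<open>U J\<close> and the \<open>m\<close> points that are met make up at least
      \<open>|E| \<ge> 3\<close>, more than the two classes.\<close>
    case J
    obtain L where L: "L \<in> P" "L \<noteq> J"
      using J P(1) by (metis Union_empty ccpo_Sup_singleton empty_iff insertI1 is_singletonI' is_singleton_def singletonD)
    have "L \<inter> J = {}" using P(2) J(1) L by (auto simp: disjoint_def)
    then have L': "L = {T}" using fK[OF L(1)] S(1) by auto
    have PJ: "K = J \<or> K = {T}" if "K \<in> P" for K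
    proof (rule ccontr)
      assume "\<not> ?thesis"
      then have "K \<inter> J = {}" "K \<inter> {T} = {}" using P(2) J(1) L(1) that by (auto simp: disjoint_def L')
      then show False using fK[OF that] S(1) by auto
    qed
    have P2: "P = {J, {T}}" using PJ J(1) L(1) L' by blast
    have JT: "J \<noteq> {T}" using TJ by blast
    then have c: "card P = 2" by (simp add: P2)
    have SJT: "S = insert T J" using P(1) P2 by auto
    have "int (card (N - U J)) \<le> int (card (U J - E)) - s J"
      unfolding U_def s_def using p SJT by (intro excess_J_ge) auto
    moreover have "(\<Sum>K\<in>P. int (card (U K - E)) - s K) =
        (int (card (U J - E)) - s J) + (int (card (p T - E)) - (int (card (p T)) - 2))"
      using JT unfolding P2 U_def s_def by (subst sum.insert) auto
    moreover have "card E \<le> card (N - U J) + m"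
    proof -
      have "card E \<le> card ((N - U J) \<union> (U S \<inter> E))"
        using finite_N edge_subset[OF E_edge] fU[of S] by (intro card_mono) (auto simp: U_def SJT)
      then show ?thesis using card_Un_le[of "N - U J" "U S \<inter> E"] m_def by linarith
    qed
    moreover have "3 \<le> card E" using card_edge E_edge by blast
    moreover have "card (p T) \<le> 2 + card (p T - E)"
    proof (cases "card (p T) = 3")
      case True
      have "p T \<subseteq> T" using p SJT by auto
      then have "p T = T" using True T(1) fA[of T] by (intro card_subset_eq) auto
      then have "p T - E \<noteq> {}" using T(2)[OF E_edge] by auto
      then have "0 < card (p T - E)" using fA[of T] \<open>p T = T\<close> by (auto simp: card_gt_0_iff)
      then show ?thesis using True by simp
    next
      case False
      have "card (p T) \<le> card T" using p SJT fA[of T] by (intro card_mono) auto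
      then show ?thesis using False T(1) by simp
    qed
    ultimately show ?thesis using total c by simp
  next
    case small
    \<comment> \<open>A class without \<open>T\<close> is a proper subfamily of \<open>J\<close> and
      has excess at least 1 outside \<open>E\<close>. The class of \<open>T\<close> may spend this
      surplus on \<open>T\<close>, for which \<open>|T| - 2 = 1\<close>.\<close>
    have u: "(if T \<in> K then 0 else 1) \<le> int (card (U K - E)) - s K" if "K \<in> P" for K
    proof -
      have "(if T \<in> K then 0 else 1) \<le> int (card (\<Union>K - E)) - (\<Sum>A\<in>K. int (card A) - 2)"
      proof (cases "T \<in> K")
        case False
        then have "K \<subset> J" using fK[OF that] S(1) that small by auto
        then show ?thesis using card_outside_E[of K] fK[OF that] False by simp
      next
        case True
        define K0 where "K0 = K - {T}"
        have K0: "K = insert T K0" "T \<notin> K0" "K0 \<subseteq> J" "finite K0"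
          using True fK[OF that] S(1) by (auto simp: K0_def)
        have sum: "(\<Sum>A\<in>K. int (card A) - 2) = 1 + (\<Sum>A\<in>K0. int (card A) - 2)"
          using K0 T(1) by simp
        have fUK: "finite (\<Union>K)" using fK[OF that] SN by (intro finite_subset[OF _ finite_N]) auto
        have "K0 \<noteq> J"
        proof
          assume "K0 = J"
          then have "K = S" using K0 S(1) fK[OF that] by auto
          have "L = S" if "L \<in> P" for L
          proof (rule ccontr)
            assume "L \<noteq> S"
            then have "L \<inter> S = {}" using P(2) that \<open>K \<in> P\<close> \<open>K = S\<close> by (auto simp: disjoint_def)
            then show False using fK[OF that] by auto
          qed
          then have "P = {S}" using that \<open>K = S\<close> by blast
          then show False using small by simp
        qed
        show ?thesis
        proof (cases "K0 = {}")
          case True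
          have "T - E \<noteq> {}" using T(2)[OF E_edge] by auto
          then have "0 < card (T - E)" using fA[of T] by (auto simp: card_gt_0_iff)
          then show ?thesis using True K0 T(1) by simp
        next
          case False
          have "card (\<Union>K0 - E) \<le> card (\<Union>K - E)" using fUK K0 by (intro card_mono) auto
          moreover have "(\<Sum>A\<in>K0. int (card A) - 2) + 1 \<le> int (card (\<Union>K0 - E))"
            using K0(3) \<open>K0 \<noteq> J\<close> False by (intro card_outside_E) auto
          ultimately show ?thesis using sum \<open>T \<in> K\<close> by simp
        qed
      qed
      then show ?thesis using mono[of K E] fK[OF that] by linarith
    qed
    have cP: "0 < card P" using fP P(1) S(2) by (auto simp: card_gt_0_iff)
    \<comment> \<open>If \<open>m \<ge> 2\<close>, the points on \<open>E\<close> outweigh the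
      single class that may have excess 0. Otherwise each class keeps at least \<open>2 - m\<close>
      outside \<open>E\<close>, because its full excess is at least 2.\<close>
    show ?thesis
    proof (cases "2 \<le> m")
      case True
      have "card {K\<in>P. T \<in> K} \<le> 1"
        using P(2) fP by (intro card_le_Suc0_iff_eq[THEN iffD2, folded One_nat_def]) (auto simp: disjoint_def)
      moreover have "(\<Sum>K\<in>P. (if T \<in> K then 0 else 1 :: int)) = int (card P) - int (card {K\<in>P. T \<in> K})"
      proof -
        have "(\<Sum>K\<in>P. (if T \<in> K then 0 else 1 :: int)) = (\<Sum>K\<in>P. 1 - (if T \<in> K then 1 else 0))"
          by (intro sum.cong) auto
        then show ?thesis using fP by (simp add: sum_subtractf sum.If_cases Int_def conj_commute)
      qed
      moreover have "(\<Sum>K\<in>P. (if T \<in> K then 0 else 1 :: int)) \<le> (\<Sum>K\<in>P. int (card (U K - E)) - s K)"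
        by (intro sum_mono u)
      ultimately show ?thesis using total True by linarith
    next
      case False
      have "2 - int m \<le> int (card (U K - E)) - s K" if "K \<in> P" for K
      proof -
        have "card (U K) \<le> card ((U K - E) \<union> (U S \<inter> E))"
          using fU fK[OF that] by (intro card_mono) (auto simp: U_def)
        also have "\<dots> \<le> card (U K - E) + m" unfolding m_def by (rule card_Un_le)
        finally show ?thesis using ge2[of K] fK[OF that] by linarith
      qed
      then have "int (card P) * (2 - int m) \<le> (\<Sum>K\<in>P. int (card (U K - E)) - s K)"
        by (metis (no_types, lifting) sum_bounded_below)
      moreover have "m = 0 \<or> m = 1" using False by linarith
      ultimately show ?thesis using total cP by auto
    qed
  qed
  then show ?thesis by (simp add: U_def s_def)
qed

subsection \<open>Generic abscissas and stresses\<close>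

text \<open>A circuit of the row matroid: in a minimal dependent set a zero coefficient would leave
  a dependency on fewer rows.\<close>

lemma dependent_rows_circuit:
  assumes "finite Q0" "\<not> indep_rows f Q0 C"
  shows "\<exists>Q w. Q \<subseteq> Q0 \<and> Q \<noteq> {} \<and> (\<forall>c\<in>C. (\<Sum>q\<in>Q. w q * f q c) = 0) \<and>
    (\<forall>q\<in>Q. w q \<noteq> 0 \<and> indep_rows f (Q - {q}) C)"
proof -
  obtain Q where Q: "Q \<in> {Q. Q \<subseteq> Q0 \<and> \<not> indep_rows f Q C}"
      "\<And>Q'. Q' \<in> {Q. Q \<subseteq> Q0 \<and> \<not> indep_rows f Q C} \<Longrightarrow> Q' \<subseteq> Q \<Longrightarrow> Q = Q'"
    using finite_has_minimal[of "{Q. Q \<subseteq> Q0 \<and> \<not> indep_rows f Q C}"] assms by auto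
  have fQ: "finite Q" using Q(1) assms(1) finite_subset by auto
  have ind: "indep_rows f (Q - {q}) C" if "q \<in> Q" for q
    using Q(2)[of "Q - {q}"] Q(1) that by auto
  obtain w q1 where w: "\<And>c. c \<in> C \<Longrightarrow> (\<Sum>q\<in>Q. w q * f q c) = 0" and q1: "q1 \<in> Q" "w q1 \<noteq> 0"
    using Q(1) unfolding indep_rows_def by blast
  have "w q \<noteq> 0" if "q \<in> Q" for q
  proof
    assume z: "w q = 0"
    then have "(\<Sum>q\<in>Q - {q}. w q * f q c) = 0" if "c \<in> C" for c
      using w[OF that] sum.remove[OF fQ \<open>q \<in> Q\<close>, of "\<lambda>q. w q * f q c"] z by simp
    then have "w q1 = 0" using indep_rowsD[OF ind[OF that], of w q1] q1 z by auto
    then show False using q1 by simp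
  qed
  then show ?thesis using Q(1) q1 w ind by (intro exI[of _ Q] exI[of _ w]) auto
qed

text \<open>A point \<open>i\<close> on a line \<open>A\<close> gives the equation \<open>y i - x i * a A - b A = 0\<close> in the unknown heights
  \<open>y\<close>, slopes \<open>a\<close> and intercepts \<open>b\<close>, which index the columns in this order.\<close>

definition inc_row :: "('a \<Rightarrow> 'k::field) \<Rightarrow> 'a \<times> 'a set \<Rightarrow> 'a + 'a set + 'a set \<Rightarrow> 'k" where
  "inc_row x q c = (case c of
      Inl i \<Rightarrow> (if fst q = i then 1 else 0)
    | Inr (Inl A) \<Rightarrow> (if snd q = A then - x (fst q) else 0)
    | Inr (Inr A) \<Rightarrow> (if snd q = A then - 1 else 0))"

text \<open>The partial derivative of \<open>inc_row x\<close> in the abscissa of \<open>i0\<close>.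
  The rows are affine in \<open>x\<close>, so the first-order expansion \<open>inc_row_upd\<close>
  is exact.\<close>

definition inc_row_deriv :: "'a \<Rightarrow> 'a \<times> 'a set \<Rightarrow> 'a + 'a set + 'a set \<Rightarrow> 'k::field" where
  "inc_row_deriv i0 q c = (case c of
      Inl i \<Rightarrow> 0
    | Inr (Inl A) \<Rightarrow> (if snd q = A \<and> fst q = i0 then - 1 else 0)
    | Inr (Inr A) \<Rightarrow> 0)"

definition inc_columns :: "'a set \<Rightarrow> 'a set set \<Rightarrow> ('a + 'a set + 'a set) set" where
  "inc_columns M S = Inl ` M \<union> (Inr ` Inl ` S \<union> Inr ` Inr ` S)"

text \<open>Every subset of \<open>N\<close> is allowed as a line, so that genericity does not
  depend on the triple \<open>T\<close>.\<close>

definition incidences :: "'a set \<Rightarrow> ('a \<times> 'a set) set" where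
  "incidences N = {(i, A). A \<subseteq> N \<and> i \<in> A}"

lemma finite_incidences: "finite N \<Longrightarrow> finite (incidences N)"
  by (rule finite_subset[of _ "N \<times> Pow N"]) (auto simp: incidences_def)

lemma finite_inc_columns: "finite M \<Longrightarrow> finite S \<Longrightarrow> finite (inc_columns M S)"
  by (simp add: inc_columns_def)

lemma sum_inc_columns:
  assumes "finite M" "finite S"
  shows "(\<Sum>c\<in>inc_columns M S. h c) =
    (\<Sum>i\<in>M. h (Inl i)) + ((\<Sum>A\<in>S. h (Inr (Inl A))) + (\<Sum>A\<in>S. h (Inr (Inr A))))"
proof -
  have "(\<Sum>c\<in>inc_columns M S. h c) =
      (\<Sum>c\<in>Inl ` M. h c) + ((\<Sum>c\<in>Inr ` Inl ` S. h c) + (\<Sum>c\<in>Inr ` Inr ` S. h c))"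
    unfolding inc_columns_def using assms by (subst sum.union_disjoint; (subst sum.union_disjoint)?) auto
  then show ?thesis by (simp add: sum.reindex inj_on_def)
qed

lemma card_inc_columns:
  assumes "finite M" "finite S"
  shows "card (inc_columns M S) = card M + 2 * card S"
  using sum_inc_columns[OF assms, of "\<lambda>_. 1::nat"] by simp

lemma inc_row_pairing:
  assumes "finite M" "finite S" "fst q \<in> M" "snd q \<in> S"
  shows "(\<Sum>c\<in>inc_columns M S. inc_row x q c * v c) =
    v (Inl (fst q)) - x (fst q) * v (Inr (Inl (snd q))) - v (Inr (Inr (snd q)))"
  using assms by (simp add: sum_inc_columns inc_row_def if_distrib[of "\<lambda>z. z * _"] cong: if_cong)

lemma inc_row_deriv_pairing:
  assumes "finite M" "finite S" "fst q \<in> M" "snd q \<in> S"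
  shows "(\<Sum>c\<in>inc_columns M S. inc_row_deriv i0 q c * v c) =
    (if fst q = i0 then - v (Inr (Inl (snd q))) else 0)"
  using assms by (simp add: sum_inc_columns inc_row_deriv_def if_distrib[of "\<lambda>z. z * _"] cong: if_cong)

lemma inc_row_upd:
  "inc_row (x(i0 := x i0 + t)) q c = inc_row x q c + t * inc_row_deriv i0 q c"
  by (auto simp: inc_row_def inc_row_deriv_def split: sum.split)

section \<open>Admissible and generic abscissas\<close>

definition admissible :: "'a set \<Rightarrow> 'a set \<Rightarrow> ('a \<Rightarrow> 'k::field) \<Rightarrow> bool" where
  "admissible N E x \<longleftrightarrow> (\<forall>i\<in>E. x i = 0) \<and> inj_on x (N - E) \<and> (\<forall>i\<in>N - E. x i \<noteq> 0)"

definition indep_sets :: "'a set \<Rightarrow> ('a \<Rightarrow> 'k::field) \<Rightarrow> ('a \<times> 'a set) set set" where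
  "indep_sets N x = {Q. Q \<subseteq> incidences N \<and> indep_rows (inc_row x) Q (inc_columns N (Pow N))}"

text \<open>Genericity is inclusion-maximality of the family of independent sets of incidences. It
  replaces a nonvanishing condition on minors and needs no transcendental coordinates.\<close>

definition generic :: "'a set \<Rightarrow> 'a set \<Rightarrow> ('a \<Rightarrow> 'k::field) \<Rightarrow> bool" where
  "generic N E x \<longleftrightarrow> admissible N E x \<and>
    (\<forall>x'. admissible N E x' \<longrightarrow> \<not> indep_sets N x \<subset> indep_sets N (x' :: 'a \<Rightarrow> 'k))"

lemma admissible_exists:
  assumes "finite N" "infinite (UNIV :: 'k::field set)"
  shows "\<exists>x :: 'a \<Rightarrow> 'k. admissible N E x"
proof -
  have "infinite (UNIV - {0 :: 'k})" using assms(2) by simp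
  then obtain B where B: "finite B" "card B = card (N - E)" "B \<subseteq> UNIV - {0 :: 'k}"
    by (meson infinite_arbitrarily_large)
  then obtain f where f: "bij_betw f (N - E) B"
    using assms(1) by (metis finite_Diff finite_same_card_bij)
  have "admissible N E (\<lambda>i. if i \<in> E then 0 else f i)"
    unfolding admissible_def
  proof (intro conjI ballI)
    have "inj_on f (N - E)" using f by (simp add: bij_betw_def)
    then show "inj_on (\<lambda>i. if i \<in> E then 0 else f i) (N - E)" by (auto simp: inj_on_def)
    show "(if i \<in> E then 0 else f i) \<noteq> 0" if "i \<in> N - E" for i
      using that f B(3) by (auto dest: bij_betwE)
  qed simp
  then show ?thesis by blast
qed

text \<open>Only finitely many families of sets of incidences exist, so one of those attained is
  maximal.\<close>

lemma generic_exists: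
  assumes "finite N" "infinite (UNIV :: 'k::field set)"
  shows "\<exists>x :: 'a \<Rightarrow> 'k. generic N E x"
proof -
  let ?X = "Collect (admissible N E) :: ('a \<Rightarrow> 'k) set"
  have "indep_sets N ` ?X \<subseteq> Pow (Pow (incidences N))" unfolding indep_sets_def by blast
  then have fin: "finite (indep_sets N ` ?X)"
    by (rule finite_subset) (simp add: finite_incidences[OF assms(1)])
  obtain x0 :: "'a \<Rightarrow> 'k" where "admissible N E x0" using admissible_exists[OF assms] ..
  then have "indep_sets N ` ?X \<noteq> {}" by blast
  from finite_has_maximal[OF fin this] obtain m where m: "m \<in> indep_sets N ` ?X"
      "\<forall>b\<in>indep_sets N ` ?X. m \<subseteq> b \<longrightarrow> m = b" ..
  from m(1) obtain x :: "'a \<Rightarrow> 'k" where x: "admissible N E x" "m = indep_sets N x" by blast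
  then have "generic N E x" using m(2) unfolding generic_def by blast
  then show ?thesis by blast
qed

lemma finite_not_admissible_upd:
  assumes "finite N" "admissible N E x" "i0 \<in> N - E"
  shows "finite {t. \<not> admissible N E (x(i0 := x i0 + t))}"
proof (rule finite_subset)
  show "{t. \<not> admissible N E (x(i0 := x i0 + t))} \<subseteq> insert (- x i0) ((\<lambda>j. x j - x i0) ` (N - E))"
  proof
    fix t assume "t \<in> {t. \<not> admissible N E (x(i0 := x i0 + t))}"
    moreover have "admissible N E (x(i0 := x i0 + t))"
      if "t \<noteq> - x i0" "\<And>j. j \<in> N - E \<Longrightarrow> t \<noteq> x j - x i0"
    proof -
      have "x i0 + t \<noteq> 0" using that(1) by (simp add: add_eq_0_iff)
      moreover have "x i0 + t \<noteq> x j" if "j \<in> N - E" for j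
        using \<open>\<And>j. j \<in> N - E \<Longrightarrow> t \<noteq> x j - x i0\<close>[OF that] by (auto simp: algebra_simps)
      then have "inj_on (x(i0 := x i0 + t)) (N - E)"
        using assms(2) by (intro inj_on_fun_updI) (auto simp: admissible_def)
      ultimately show ?thesis using assms(2,3) by (auto simp: admissible_def)
    qed
    ultimately show "t \<in> insert (- x i0) ((\<lambda>j. x j - x i0) ` (N - E))" by auto
  qed
qed (use assms in simp)

text \<open>If the sum were nonzero, then the rows of the circuit \<open>Q\<close> would become independent when
  \<open>x i0\<close> is moved, contrary to genericity.\<close>

lemma generic_stress:
  fixes x :: "'a \<Rightarrow> 'k::field"
  assumes fin: "finite N" and inf: "infinite (UNIV :: 'k set)" and gen: "generic N E x"
    and i0: "i0 \<in> N - E" and Q: "Q \<subseteq> incidences N"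
    and w: "\<And>c. c \<in> inc_columns N (Pow N) \<Longrightarrow> (\<Sum>q\<in>Q. w q * inc_row x q c) = 0"
    and q0: "q0 \<in> Q" "w q0 \<noteq> 0" "indep_rows (inc_row x) (Q - {q0}) (inc_columns N (Pow N))"
    and y: "\<And>q. q \<in> Q \<Longrightarrow> y (fst q) = x (fst q) * a (snd q) + b (snd q)"
  shows "(\<Sum>q\<in>Q. if fst q = i0 then w q * a (snd q) else 0) = 0"
proof (rule ccontr)
  assume nz: "\<not> ?thesis"
  let ?C = "inc_columns N (Pow N)"
  have finQ: "finite R" if "R \<subseteq> incidences N" for R
    using finite_incidences[OF fin] that finite_subset by blast
  note fQ = finQ[OF Q]
  have QN: "fst q \<in> N" "snd q \<in> Pow N" if "q \<in> Q" for q
    using subsetD[OF Q that] by (auto simp: incidences_def)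
  define D where "D = (inc_row_deriv i0 :: _ \<Rightarrow> _ \<Rightarrow> 'k)"
  \<comment> \<open>\<open>v\<close> is the derivative of the stressed sum of rows: after a shift by
    \<open>t\<close> that sum is \<open>t * v\<close> instead of 0.\<close>
  define v where "v = (\<lambda>c. \<Sum>q\<in>Q. w q * D q c)"
  \<comment> \<open>The row of \<open>q0\<close> is replaced by \<open>v\<close>;
    \<open>f + t * g\<close> is the shifted matrix with the same replacement.\<close>
  define f where "f = (\<lambda>q c. if q = q0 then v c else inc_row x q c)"
  define g where "g = (\<lambda>q c. if q = q0 then 0 else D q c)"
  define \<eta> where "\<eta> = case_sum y (case_sum a b)"
  have split: "(\<Sum>q\<in>Q. h q) = h q0 + (\<Sum>q\<in>Q - {q0}. h q)" for h :: "_ \<Rightarrow> 'k"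
    using fQ q0(1) by (rule sum.remove)
  have row: "(\<Sum>c\<in>?C. inc_row x q c * \<eta> c) = 0" if "q \<in> Q" for q
    using inc_row_pairing[of N "Pow N" q x \<eta>] fin QN[OF that] y[OF that] by (simp add: \<eta>_def)
  have "(\<Sum>c\<in>?C. v c * \<eta> c) = (\<Sum>q\<in>Q. w q * (\<Sum>c\<in>?C. D q c * \<eta> c))"
    unfolding v_def sum_distrib_left sum_distrib_right by (subst sum.swap) (simp add: mult.assoc)
  also have "\<dots> = (\<Sum>q\<in>Q. - (if fst q = i0 then w q * a (snd q) else 0))"
    using inc_row_deriv_pairing[of N "Pow N" _ i0 \<eta>] fin QN
    by (intro sum.cong refl) (auto simp: D_def \<eta>_def)
  finally have v\<eta>: "(\<Sum>c\<in>?C. v c * \<eta> c) \<noteq> 0" using nz by (simp add: sum_negf)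
  \<comment> \<open>The solution vector \<open>\<eta>\<close> annihilates every row of
    \<open>Q\<close> but not \<open>v\<close>, so \<open>v\<close> is outside the span of the
    remaining rows, which are independent.\<close>
  have "indep_rows f Q ?C"
  proof (rule indep_rowsI)
    fix u q assume u: "\<And>c. c \<in> ?C \<Longrightarrow> (\<Sum>q\<in>Q. u q * f q c) = 0" and q: "q \<in> Q"
    have u': "u q0 * v c + (\<Sum>q\<in>Q - {q0}. u q * inc_row x q c) = 0" if "c \<in> ?C" for c
      using u[OF that] unfolding split by (simp add: f_def)
    have "0 = (\<Sum>c\<in>?C. (u q0 * v c + (\<Sum>q\<in>Q - {q0}. u q * inc_row x q c)) * \<eta> c)"
      using u' by simp
    also have "\<dots> = u q0 * (\<Sum>c\<in>?C. v c * \<eta> c) + (\<Sum>q\<in>Q - {q0}. u q * (\<Sum>c\<in>?C. inc_row x q c * \<eta> c))"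
      unfolding distrib_right sum.distrib sum_distrib_left sum_distrib_right
      by (subst (2) sum.swap) (simp add: mult.assoc)
    also have "(\<Sum>q\<in>Q - {q0}. u q * (\<Sum>c\<in>?C. inc_row x q c * \<eta> c)) = 0"
      using row by (intro sum.neutral) auto
    finally have 0: "u q0 = 0" using v\<eta> by simp
    then show "u q = 0"
      using indep_rowsD[OF q0(3), of u q] u' q by (cases "q = q0") auto
  qed
  then have f1: "finite {t. \<not> indep_rows (\<lambda>q c. f q c + t * g q c) Q ?C}"
    by (rule finite_dependent_pencil[OF fQ])
  \<comment> \<open>To contradict maximality the shift must also preserve every set that is
    independent for \<open>x\<close>.\<close>
  have f2: "finite (\<Union>R\<in>indep_sets N x. {t. \<not> indep_rows (\<lambda>q c. inc_row x q c + t * D q c) R ?C})"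
  proof (intro finite_UN_I)
    show "finite (indep_sets N x)"
      using finite_incidences[OF fin] by (auto simp: indep_sets_def)
    show "finite {t. \<not> indep_rows (\<lambda>q c. inc_row x q c + t * D q c) R ?C}" if "R \<in> indep_sets N x" for R
      using that finQ by (intro finite_dependent_pencil) (auto simp: indep_sets_def)
  qed
  have f3: "finite {t. \<not> admissible N E (x(i0 := x i0 + t))}"
    using finite_not_admissible_upd[OF fin _ i0] gen by (auto simp: generic_def)
  have "finite (insert 0 ({t. \<not> indep_rows (\<lambda>q c. f q c + t * g q c) Q ?C} \<union>
      (\<Union>R\<in>indep_sets N x. {t. \<not> indep_rows (\<lambda>q c. inc_row x q c + t * D q c) R ?C}) \<union>
      {t. \<not> admissible N E (x(i0 := x i0 + t))}))"
    by (intro finite.insertI finite_UnI f1 f2 f3)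
  from ex_new_if_finite[OF inf this] obtain t where "t \<notin> insert 0 ({t. \<not> indep_rows (\<lambda>q c. f q c + t * g q c) Q ?C} \<union>
      (\<Union>R\<in>indep_sets N x. {t. \<not> indep_rows (\<lambda>q c. inc_row x q c + t * D q c) R ?C}) \<union>
      {t. \<not> admissible N E (x(i0 := x i0 + t))})" ..
  then have t: "t \<noteq> 0" "indep_rows (\<lambda>q c. f q c + t * g q c) Q ?C"
      "\<And>R. R \<in> indep_sets N x \<Longrightarrow> indep_rows (\<lambda>q c. inc_row x q c + t * D q c) R ?C"
      "admissible N E (x(i0 := x i0 + t))"
    by auto
  define x' where "x' = x(i0 := x i0 + t)"
  have x': "inc_row x' = (\<lambda>q c. inc_row x q c + t * D q c)"
    unfolding x'_def D_def by (intro ext inc_row_upd)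
  have tv: "t * v c = (\<Sum>q\<in>Q. w q * inc_row x' q c)" if "c \<in> ?C" for c
    using w[OF that] by (simp add: x' v_def distrib_left sum.distrib sum_distrib_left mult_ac)
  have "indep_rows (inc_row x') Q ?C"
  proof (rule indep_rowsI)
    fix u q assume u: "\<And>c. c \<in> ?C \<Longrightarrow> (\<Sum>q\<in>Q. u q * inc_row x' q c) = 0" and q: "q \<in> Q"
    define r where "r = u q0 / w q0"
    \<comment> \<open>For \<open>t \<noteq> 0\<close> the shifted row of \<open>q0\<close> can be
      traded for \<open>v\<close>, since the stressed sum of the shifted rows is
      \<open>t * v\<close>; \<open>u'\<close> holds the coefficients after this exchange.\<close>
    define u' where "u' = (\<lambda>q. if q = q0 then t * r else u q - r * w q)"
    have rq: "u q0 = r * w q0" using q0(2) by (simp add: r_def)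
    have z: "u' q = 0" if "q \<in> Q" for q
    proof (rule indep_rowsD[OF t(2) _ that])
      fix c assume c: "c \<in> ?C"
      have "(\<Sum>q\<in>Q. u' q * (f q c + t * g q c)) =
          r * (t * v c) + (\<Sum>q\<in>Q - {q0}. (u q - r * w q) * inc_row x' q c)"
        unfolding split by (simp add: u'_def f_def g_def x')
      also have "\<dots> = (\<Sum>q\<in>Q. u q * inc_row x' q c)"
        unfolding tv[OF c] split[of "\<lambda>q. u q * inc_row x' q c"] split[of "\<lambda>q. w q * inc_row x' q c"] rq
        by (simp add: algebra_simps sum_subtractf sum_distrib_left)
      finally show "(\<Sum>q\<in>Q. u' q * (f q c + t * g q c)) = 0" using u[OF c] by simp
    qed
    have "r = 0" using z[OF q0(1)] t(1) by (simp add: u'_def)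
    then show "u q = 0" using z[OF q] rq by (auto simp: u'_def split: if_splits)
  qed
  then have "Q \<in> indep_sets N x'" using Q by (simp add: indep_sets_def)
  moreover have "Q \<notin> indep_sets N x"
    using indep_rowsD[of "inc_row x" Q ?C w q0] w q0 by (auto simp: indep_sets_def)
  moreover have "indep_sets N x \<subseteq> indep_sets N x'"
    using t(3) by (auto simp: x' indep_sets_def)
  ultimately have "indep_sets N x \<subset> indep_sets N x'" by blast
  then show False using gen t(4) by (auto simp: generic_def x'_def)
qed

text \<open>A circuit \<open>Q\<close> of incidences would force all lines of \<open>Q\<close> to have the same intercept in every
  solution of the equations \<open>Q\<close>; counting unknowns then contradicts \<open>excess_gt_card_partition\<close>.\<close>

lemma (in irreducible_edges) generic_rows_independent:
  fixes x :: "'a \<Rightarrow> 'k::field"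
  assumes inf: "infinite (UNIV :: 'k set)" and gen: "generic N E x"
    and T: "card T = 3" "\<And>A. A \<in> G \<Longrightarrow> \<not> T \<subseteq> A" "T \<subseteq> N"
  shows "indep_rows (inc_row x) {(i, A). A \<in> insert T J \<and> i \<in> A} (inc_columns N (Pow N))"
proof (rule ccontr)
  let ?Q0 = "{(i, A). A \<in> insert T J \<and> i \<in> A}"
  let ?C = "inc_columns N (Pow N)"
  assume dep: "\<not> ?thesis"
  have Q0: "?Q0 \<subseteq> incidences N" using T(3) edge_subset by (auto simp: incidences_def)
  have fQ0: "finite ?Q0" using finite_subset[OF Q0 finite_incidences[OF finite_N]] .
  from dependent_rows_circuit[OF fQ0 dep] obtain Q w where "Q \<subseteq> ?Q0 \<and> Q \<noteq> {} \<and>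
      (\<forall>c\<in>?C. (\<Sum>q\<in>Q. w q * inc_row x q c) = 0) \<and>
      (\<forall>q\<in>Q. w q \<noteq> 0 \<and> indep_rows (inc_row x) (Q - {q}) ?C)"
    by (elim exE)
  then have Q: "Q \<subseteq> ?Q0" "Q \<noteq> {}"
    and w: "\<And>c. c \<in> ?C \<Longrightarrow> (\<Sum>q\<in>Q. w q * inc_row x q c) = 0"
    and wnz: "\<And>q. q \<in> Q \<Longrightarrow> w q \<noteq> 0"
    and ind: "\<And>q. q \<in> Q \<Longrightarrow> indep_rows (inc_row x) (Q - {q}) ?C"
    by blast+
  have fQ: "finite Q" using Q(1) fQ0 finite_subset by blast
  have QN: "Q \<subseteq> incidences N" using Q(1) Q0 by blast
  define S where "S = snd ` Q"
  define p where "p = (\<lambda>A. {i. (i, A) \<in> Q})"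
  have S: "S \<subseteq> insert T J" "S \<noteq> {}" "finite S" using Q fQ by (auto simp: S_def)
  have fstQ: "fst ` Q = (\<Union>A\<in>S. p A)" by (force simp: S_def p_def)
  have "fst q \<in> N \<and> snd q \<subseteq> N" if "q \<in> Q" for q
    using subsetD[OF QN that] by (auto simp: incidences_def)
  then have SN: "S \<subseteq> Pow N" "fst ` Q \<subseteq> N" by (auto simp: S_def)
  have "p A \<subseteq> fst ` Q" for A by (auto simp: p_def image_iff Bex_def)
  then have fp: "finite (p A)" for A using fQ finite_subset by blast
  have cardQ: "card Q = (\<Sum>A\<in>S. card (p A))"
  proof -
    have "Q = prod.swap ` (SIGMA A:S. p A)" by (auto simp: S_def p_def image_iff Bex_def)
    then have "card Q = card (SIGMA A:S. p A)"
      by (metis card_image inj_on_subset inj_swap subset_UNIV)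
    then show ?thesis using S(3) fp by simp
  qed
  \<comment> \<open>Two lines of the stress are adjacent if they share one of its points outside
    \<open>E\<close>; \<open>P\<close> is the set of connected components.\<close>
  define r where "r = {(A, B). A \<in> S \<and> B \<in> S \<and> p A \<inter> p B - E \<noteq> {}}"
  define R where "R = {(A, B). A \<in> S \<and> B \<in> S \<and> (A, B) \<in> r\<^sup>*}"
  have "sym r" by (auto simp: r_def sym_def)
  then have "sym (r\<^sup>*)" by (rule sym_rtrancl)
  have "equiv S R"
    by (auto simp: R_def equiv_def refl_on_def sym_def trans_def
        intro: rtrancl_trans symD[OF \<open>sym (r\<^sup>*)\<close>])
  define P where "P = S // R"
  have P: "\<Union>P = S" "disjoint P" "{} \<notin> P"
    unfolding P_def disjoint_def
    using Union_quotient[OF \<open>equiv S R\<close>] quotient_disj[OF \<open>equiv S R\<close>]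
      in_quotient_imp_non_empty[OF \<open>equiv S R\<close>] by blast+
  have fP: "finite P" using P(1) S(3) by (metis finite_UnionD)
  have "int (card P) < int (card (\<Union>A\<in>S. p A)) - (\<Sum>A\<in>S. int (card (p A)) - 2)"
  proof (rule excess_gt_card_partition[OF T])
    show "p A \<subseteq> A" if "A \<in> S" for A using Q(1) by (auto simp: p_def)
    show "((\<Union>A\<in>K. p A) - E) \<inter> ((\<Union>A\<in>L. p A) - E) = {}" if KL: "K \<in> P" "L \<in> P" "K \<noteq> L" for K L
    proof (rule ccontr)
      assume "\<not> ?thesis"
      then obtain i A B where AB: "A \<in> K" "B \<in> L" "i \<in> p A" "i \<in> p B" "i \<notin> E" by auto
      then have "(A, B) \<in> R" using KL P(1) by (auto simp: R_def r_def)
      then have "B \<in> K"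
        using KL(1) AB(1) in_quotient_imp_closed[OF \<open>equiv S R\<close>] by (auto simp: P_def)
      then show False using P(2) KL AB(2) by (auto simp: disjoint_def)
    qed
  qed (use S P in auto)
  then have count: "card Q + card P < card (fst ` Q) + 2 * card S"
    using cardQ fstQ S(3) by (simp add: sum_subtractf flip: of_nat_sum)
  obtain q0 where q0: "q0 \<in> Q" using Q(2) by blast
  define rep where "rep = (\<lambda>K :: 'a set set. SOME A. A \<in> K)"
  have rep: "rep K \<in> K" if "K \<in> P" for K
    using that P(3) unfolding rep_def by (metis some_in_eq)
  let ?V = "inc_columns (fst ` Q) S"
  have VC: "?V \<subseteq> ?C" using SN by (auto simp: inc_columns_def)
  have fV: "finite ?V" using fQ S(3) by (simp add: finite_inc_columns)
  \<comment> \<open>The equations in \<open>Q\<close> are normalized by one zero intercept and one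
    zero slope per class. The equation of \<open>q0\<close> is left out because the stress implies
    it, so the total is \<open>card Q + card P\<close>, below the number of unknowns.\<close>
  define eqs where "eqs = (Q - {q0}) <+> insert None (Some ` P)"
  define coeff where "coeff = (\<lambda>e c. case e of Inl q \<Rightarrow> inc_row x q c
    | Inr None \<Rightarrow> (if c = Inr (Inr (snd q0)) then 1 else 0)
    | Inr (Some K) \<Rightarrow> (if c = Inr (Inl (rep K)) then 1 else (0 :: 'k)))"
  have "card eqs = card Q + card P"
  proof -
    have "card eqs = card (Q - {q0}) + card (insert None (Some ` P))"
      unfolding eqs_def using fQ fP by (intro card_Plus) auto
    also have "card (insert None (Some ` P)) = Suc (card P)" using fP by (simp add: card_image)
    finally show ?thesis using card.remove[OF fQ q0] by simp
  qed
  then have "card eqs < card ?V" using count fQ S(3) by (simp add: card_inc_columns)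
  moreover have "finite eqs" using fQ fP by (simp add: eqs_def)
  ultimately obtain v where v: "\<exists>c\<in>?V. v c \<noteq> 0" "\<And>e. e \<in> eqs \<Longrightarrow> (\<Sum>c\<in>?V. coeff e c * v c) = 0"
    using underdetermined_solution[OF _ fV, of eqs coeff] by blast
  define y where "y = (\<lambda>i. v (Inl i))"
  define a where "a = (\<lambda>A. v (Inr (Inl A)))"
  define b where "b = (\<lambda>A. v (Inr (Inr A)))"
  have pair: "(\<Sum>c\<in>?V. inc_row x q c * v c) = y (fst q) - x (fst q) * a (snd q) - b (snd q)" if "q \<in> Q" for q
    using that fQ S(3) by (subst inc_row_pairing) (auto simp: S_def y_def a_def b_def)
  have eqs_mem: "Inr None \<in> eqs" "\<And>q. q \<in> Q - {q0} \<Longrightarrow> Inl q \<in> eqs" "\<And>K. K \<in> P \<Longrightarrow> Inr (Some K) \<in> eqs"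
    by (auto simp: eqs_def)
  have b0: "b (snd q0) = 0"
    using v(2)[OF eqs_mem(1)] fV q0
    by (simp add: coeff_def b_def inc_columns_def S_def if_distrib[of "\<lambda>z. z * _"] cong: if_cong)
  have arep: "a (rep K) = 0" if "K \<in> P" for K
  proof -
    have "rep K \<in> S" using rep[OF that] P(1) that by blast
    then have "Inr (Inl (rep K)) \<in> ?V" by (auto simp: inc_columns_def)
    then show ?thesis
      using v(2)[OF eqs_mem(3)[OF that]] fV
      by (simp add: coeff_def a_def if_distrib[of "\<lambda>z. z * _"] cong: if_cong)
  qed
  have row0: "(\<Sum>c\<in>?V. inc_row x q c * v c) = 0" if "q \<in> Q - {q0}" for q
    using v(2)[OF eqs_mem(2)[OF that]] by (simp add: coeff_def)
  \<comment> \<open>The stressed sum of the equations vanishes identically and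
    \<open>w q0 \<noteq> 0\<close>, so the omitted equation holds too.\<close>
  have "(\<Sum>q\<in>Q. w q * (\<Sum>c\<in>?V. inc_row x q c * v c)) = (\<Sum>c\<in>?V. (\<Sum>q\<in>Q. w q * inc_row x q c) * v c)"
    unfolding sum_distrib_left sum_distrib_right by (subst sum.swap) (simp add: mult.assoc)
  also have "\<dots> = 0" using w VC by (intro sum.neutral) auto
  finally have "w q0 * (\<Sum>c\<in>?V. inc_row x q0 c * v c) = 0"
    using row0 by (subst (asm) sum.remove[OF fQ q0]) simp
  then have sol: "y (fst q) = x (fst q) * a (snd q) + b (snd q)" if "q \<in> Q" for q
    using row0[of q] pair[OF that] pair[OF q0] wnz[OF q0] that by (cases "q = q0") (auto simp: algebra_simps)
  have adm: "\<forall>i\<in>E. x i = 0" "\<forall>i\<in>N - E. x i \<noteq> 0" using gen by (auto simp: generic_def admissible_def)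
  \<comment> \<open>At a point, \<open>b = y - x a\<close> splits the scaled stress into a multiple
    of the stress and an \<open>a\<close> part, which vanishes outside \<open>E\<close> by
    \<open>generic_stress\<close> and on \<open>E\<close> because \<open>x = 0\<close>. In the
    column of a line the intercept is a constant factor.\<close>
  have bw: "(\<Sum>q\<in>Q. (w q * b (snd q)) * inc_row x q c) = 0" if c: "c \<in> ?C" for c
  proof (cases c)
    case (Inl i)
    have i: "i \<in> N" using c Inl by (auto simp: inc_columns_def)
    have "(\<Sum>q\<in>Q. (w q * b (snd q)) * inc_row x q c) =
        (\<Sum>q\<in>Q. y i * (w q * inc_row x q c) - x i * (if fst q = i then w q * a (snd q) else 0))"
    proof (intro sum.cong refl)
      fix q assume "q \<in> Q"
      show "(w q * b (snd q)) * inc_row x q c =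
          y i * (w q * inc_row x q c) - x i * (if fst q = i then w q * a (snd q) else 0)"
      proof (cases "fst q = i")
        case True
        then show ?thesis
          using sol[OF \<open>q \<in> Q\<close>, unfolded True] by (simp add: Inl inc_row_def algebra_simps)
      qed (simp add: Inl inc_row_def)
    qed
    also have "\<dots> = y i * (\<Sum>q\<in>Q. w q * inc_row x q c) - x i * (\<Sum>q\<in>Q. if fst q = i then w q * a (snd q) else 0)"
      by (simp add: sum_subtractf sum_distrib_left)
    also have "x i * (\<Sum>q\<in>Q. if fst q = i then w q * a (snd q) else 0) = 0"
      using generic_stress[OF finite_N inf gen _ QN w q0 wnz[OF q0] ind[OF q0] sol, of i] adm(1) i
      by (cases "i \<in> E") auto
    finally show ?thesis using w[OF c] by simp
  next
    case (Inr d)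
    define B where "B = (case d of Inl A \<Rightarrow> A | Inr A \<Rightarrow> A)"
    have "(w q * b (snd q)) * inc_row x q c = b B * (w q * inc_row x q c)" for q
      by (auto simp: Inr inc_row_def B_def split: sum.split)
    then have "(\<Sum>q\<in>Q. (w q * b (snd q)) * inc_row x q c) = b B * (\<Sum>q\<in>Q. w q * inc_row x q c)"
      by (simp only: sum_distrib_left)
    then show ?thesis using w[OF c] by simp
  qed
  \<comment> \<open>As \<open>b\<close> is 0 on the line of \<open>q0\<close>, the scaled stress is
    a dependency of the independent rows \<open>Q - {q0}\<close>.\<close>
  have bz: "b A = 0" if "A \<in> S" for A
  proof -
    obtain q where q: "q \<in> Q" "snd q = A" using \<open>A \<in> S\<close> unfolding S_def by blast
    show ?thesis
    proof (cases "q = q0")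
      case False
      have "w q * b (snd q) = 0"
      proof (rule indep_rowsD[OF ind[OF q0], of "\<lambda>q. w q * b (snd q)"])
        show "(\<Sum>q\<in>Q - {q0}. (w q * b (snd q)) * inc_row x q c) = 0" if "c \<in> ?C" for c
          using bw[OF that] b0 by (subst (asm) sum.remove[OF fQ q0]) simp
      qed (use q False in simp)
      then show ?thesis using wnz[OF q(1)] q(2) by simp
    qed (use b0 q in simp)
  qed
  \<comment> \<open>With zero intercepts, a common point with nonzero abscissa forces equal
    slopes.\<close>
  have ar: "a A = a B" if "(A, B) \<in> r" for A B
  proof -
    obtain i where i: "(i, A) \<in> Q" "(i, B) \<in> Q" "i \<notin> E"
      using \<open>(A, B) \<in> r\<close> by (auto simp: r_def p_def)
    then have "x i * a A = x i * a B"
      using sol[OF i(1)] sol[OF i(2)] bz that by (auto simp: r_def)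
    moreover have "x i \<noteq> 0" using subsetD[OF QN i(1)] i(3) adm(2) by (auto simp: incidences_def)
    ultimately show ?thesis by simp
  qed
  have aR: "a A = a B" if "(A, B) \<in> r\<^sup>*" for A B
    using that by (induction rule: rtrancl_induct) (auto dest: ar)
  have az: "a A = 0" if "A \<in> S" for A
  proof -
    obtain K where K: "K \<in> P" "A \<in> K" using P(1) \<open>A \<in> S\<close> by blast
    then have "(A, rep K) \<in> R"
      using in_quotient_imp_in_rel[OF \<open>equiv S R\<close>, of K A "rep K"] rep[OF K(1)] by (simp add: P_def)
    then show ?thesis using aR arep[OF K(1)] by (auto simp: R_def)
  qed
  have "y i = 0" if "i \<in> fst ` Q" for i
  proof -
    obtain q where q: "q \<in> Q" "fst q = i" using \<open>i \<in> fst ` Q\<close> by blast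
    then have "snd q \<in> S" by (simp add: S_def)
    then show ?thesis using sol[OF q(1)] az bz q(2) by simp
  qed
  then have "v c = 0" if "c \<in> ?V" for c
    using that az bz by (auto simp: inc_columns_def y_def a_def b_def)
  then show False using v(1) by blast
qed

subsection \<open>From heights to points of the projective plane\<close>

text \<open>The determinant of the vectors \<open>(x, y, 1)\<close> of the three points.\<close>

definition area :: "('a \<Rightarrow> 'k::field) \<Rightarrow> ('a \<Rightarrow> 'k) \<Rightarrow> 'a \<Rightarrow> 'a \<Rightarrow> 'a \<Rightarrow> 'k" where
  "area x y i j k = (x j - x i) * (y k - y i) - (x k - x i) * (y j - y i)"

definition triangle :: "('a \<Rightarrow> 'k::field) \<Rightarrow> ('a \<Rightarrow> 'k) \<Rightarrow> 'a set \<Rightarrow> bool" where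
  "triangle x y T \<longleftrightarrow> (\<exists>i j k. T = {i, j, k} \<and> area x y i j k \<noteq> 0)"

lemma area_swap: "area x y j i k = - area x y i j k" "area x y i k j = - area x y i j k"
  by (simp_all add: area_def algebra_simps)

lemma area_repeated [simp]: "area x y i i j = 0" "area x y i j i = 0" "area x y j i i = 0"
  by (simp_all add: area_def)

text \<open>For fixed abscissas the area is linear in the heights, so each triple excludes finitely
  many \<open>t\<close> unless both areas vanish.\<close>

lemma area_add_scaled: "area x (\<lambda>i. y i + t * z i) i j k = area x y i j k + t * area x z i j k"
  by (simp add: area_def algebra_simps)

lemma finite_affine_zeros:
  fixes c d :: "'k::field"
  assumes "c \<noteq> 0 \<or> d \<noteq> 0"
  shows "finite {t. c + t * d = 0}"
  using poly_roots_finite[of "[:c, d:]"] assms by simp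

section \<open>Heights with prescribed collinearities\<close>

context irreducible_edges
begin

text \<open>Only the edges in \<open>J\<close> impose equations: the points of \<open>E\<close> are
  collinear by their common abscissa 0.\<close>

definition lifts :: "('a \<Rightarrow> 'k::field) \<Rightarrow> ('a \<Rightarrow> 'k) set" where
  "lifts x = {y. \<exists>a b. \<forall>A\<in>J. \<forall>i\<in>A. y i = x i * a A + b A}"

lemma lifts_add_scaled:
  assumes "y \<in> lifts x" "z \<in> lifts x"
  shows "(\<lambda>i. y i + t * z i) \<in> lifts x"
proof -
  obtain a b a' b' where "\<forall>A\<in>J. \<forall>i\<in>A. y i = x i * a A + b A" "\<forall>A\<in>J. \<forall>i\<in>A. z i = x i * a' A + b' A"
    using assms by (auto simp: lifts_def)
  then have "\<forall>A\<in>J. \<forall>i\<in>A. y i + t * z i = x i * (a A + t * a' A) + (b A + t * b' A)"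
    by (simp add: algebra_simps)
  then show ?thesis unfolding lifts_def by (intro CollectI exI)
qed

text \<open>Independent rows admit every right-hand side. All equations are made to hold exactly,
  except that one point \<open>r\<close> of \<open>T\<close> is placed at height 1 above the line of
  the other two.\<close>

lemma lift_triangle:
  fixes x :: "'a \<Rightarrow> 'k::field"
  assumes inf: "infinite (UNIV :: 'k set)" and gen: "generic N E x"
    and T: "card T = 3" "\<And>A. A \<in> G \<Longrightarrow> \<not> T \<subseteq> A" "T \<subseteq> N"
  shows "\<exists>y\<in>lifts x. triangle x y T"
proof -
  \<comment> \<open>A point outside \<open>E\<close> has an abscissa different from that of any
    other point of \<open>T\<close>, so the line through \<open>p\<close> and \<open>q\<close> is
    not vertical.\<close>
  obtain p where p: "p \<in> T" "p \<notin> E" using T(2)[OF E_edge] by blast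
  have fT: "finite T" using T(1) by (auto intro: card_ge_0_finite)
  then have "card (T - {p}) = 2" using T(1) p by simp
  then obtain q r where qr: "T - {p} = {q, r}" "q \<noteq> r" by (meson card_2_iff)
  then have Tpqr: "T = {p, q, r}" "p \<noteq> q" "p \<noteq> r" using p by auto
  have adm: "\<forall>i\<in>E. x i = 0" "inj_on x (N - E)" "\<forall>i\<in>N - E. x i \<noteq> 0"
    using gen by (auto simp: generic_def admissible_def)
  have xpq: "x p \<noteq> x q"
  proof (cases "q \<in> E")
    case True
    then show ?thesis using adm p T(3) by auto
  next
    case False
    then show ?thesis using inj_onD[OF adm(2), of p q] p T(3) Tpqr by auto
  qed
  let ?Q = "{(i, A). A \<in> insert T J \<and> i \<in> A}"
  have QN: "?Q \<subseteq> incidences N" using T(3) edge_subset by (auto simp: incidences_def)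
  have fQ: "finite ?Q" using finite_subset[OF QN finite_incidences[OF finite_N]] .
  have fC: "finite (inc_columns N (Pow N))" using finite_N by (simp add: finite_inc_columns)
  have "indep_rows (inc_row x) ?Q (inc_columns N (Pow N))"
    by (rule generic_rows_independent[OF inf gen T])
  from indep_rows_solvable[OF fQ fC this, of "\<lambda>e. if e = (r, T) then 1 else 0"]
  obtain v where v: "\<forall>e\<in>?Q. (\<Sum>c\<in>inc_columns N (Pow N). inc_row x e c * v c)
      = (if e = (r, T) then 1 else 0)" ..
  define y where "y = (\<lambda>i. v (Inl i))"
  define a where "a = (\<lambda>A. v (Inr (Inl A)))"
  define b where "b = (\<lambda>A. v (Inr (Inr A)))"
  have y: "y i = x i * a A + b A + (if i = r \<and> A = T then 1 else 0)"
    if "A \<in> insert T J" "i \<in> A" for i A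
  proof -
    have e: "(i, A) \<in> ?Q" using that by simp
    then have "i \<in> N" "A \<in> Pow N" using QN by (auto simp: incidences_def)
    then have "(\<Sum>c\<in>inc_columns N (Pow N). inc_row x (i, A) c * v c) = y i - x i * a A - b A"
      using finite_N by (subst inc_row_pairing) (auto simp: y_def a_def b_def)
    moreover have "(\<Sum>c\<in>inc_columns N (Pow N). inc_row x (i, A) c * v c) = (if i = r \<and> A = T then 1 else 0)"
      using bspec[OF v e] by simp
    ultimately show ?thesis by (simp add: algebra_simps)
  qed
  have "T \<notin> J" using T(2) by auto
  have "y i = x i * a A + b A" if "A \<in> J" "i \<in> A" for A i
    using y[of A i] that \<open>T \<notin> J\<close> by (cases "A = T") simp_all
  then have "y \<in> lifts x" unfolding lifts_def by blast
  moreover have "area x y p q r = x q - x p"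
    using y[of T p] y[of T q] y[of T r] Tpqr qr(2) by (simp add: area_def algebra_simps)
  ultimately show ?thesis using xpq Tpqr(1) unfolding triangle_def by (metis right_minus_eq)
qed

text \<open>On the pencil \<open>y + t z\<close> each of the finitely many triples excludes finitely
  many \<open>t\<close>, and the field is infinite.\<close>

lemma lift_triangle_all:
  fixes x :: "'a \<Rightarrow> 'k::field"
  assumes inf: "infinite (UNIV :: 'k set)" and gen: "generic N E x"
    and "finite \<T>" "\<And>T. T \<in> \<T> \<Longrightarrow> card T = 3 \<and> T \<subseteq> N \<and> (\<forall>A\<in>G. \<not> T \<subseteq> A)"
  shows "\<exists>y\<in>lifts x. \<forall>T\<in>\<T>. triangle x y T"
  using assms(3,4)
proof (induction \<T> rule: finite_induct)
  case empty
  have "(\<lambda>_. 0) \<in> lifts x" by (auto simp: lifts_def intro!: exI[of _ "\<lambda>_. 0"])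
  then show ?case by blast
next
  case (insert T \<T>)
  have T: "card T = 3" "T \<subseteq> N" "\<And>A. A \<in> G \<Longrightarrow> \<not> T \<subseteq> A" using insert.prems by auto
  have "\<exists>y\<in>lifts x. \<forall>T\<in>\<T>. triangle x y T" by (rule insert.IH) (use insert.prems in simp)
  then obtain y where y: "y \<in> lifts x" "\<forall>T\<in>\<T>. triangle x y T" by blast
  obtain z where z: "z \<in> lifts x" "triangle x z T"
    using lift_triangle[OF inf gen T(1,3,2)] by blast
  define bad where "bad = (\<lambda>T. {t. \<not> triangle x (\<lambda>i. y i + t * z i) T})"
  have "finite (bad T')" if T': "T' \<in> insert T \<T>" for T'
  proof -
    have "triangle x y T' \<or> triangle x z T'" using T' y(2) z(2) by blast
    then obtain i j k where ijk: "T' = {i, j, k}" and nz: "area x y i j k \<noteq> 0 \<or> area x z i j k \<noteq> 0"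
      unfolding triangle_def by blast
    have "bad T' \<subseteq> {t. area x y i j k + t * area x z i j k = 0}"
      using ijk unfolding bad_def triangle_def area_add_scaled by blast
    then show ?thesis using finite_affine_zeros[OF nz] finite_subset by blast
  qed
  then have "finite (\<Union>T'\<in>insert T \<T>. bad T')" using insert.hyps by blast
  from ex_new_if_finite[OF inf this] obtain t where t: "t \<notin> (\<Union>T'\<in>insert T \<T>. bad T')" ..
  then have "\<forall>T'\<in>insert T \<T>. triangle x (\<lambda>i. y i + t * z i) T'" by (simp add: bad_def)
  then show ?case using lifts_add_scaled[OF y(1) z(1)] by blast
qed

text \<open>One generic \<open>x\<close> serves all triples contained in no edge. Collinearity
  within edges comes from \<open>x = 0\<close> on \<open>E\<close> and from the line equations on
  \<open>J\<close>.\<close>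

lemma affine_realization:
  assumes inf: "infinite (UNIV :: 'k::field set)"
  shows "\<exists>x y :: 'a \<Rightarrow> 'k. \<forall>i\<in>N. \<forall>j\<in>N. \<forall>k\<in>N. i \<noteq> j \<longrightarrow> j \<noteq> k \<longrightarrow> i \<noteq> k \<longrightarrow>
    (area x y i j k = 0 \<longleftrightarrow> (\<exists>A\<in>G. {i, j, k} \<subseteq> A))"
proof -
  obtain x :: "'a \<Rightarrow> 'k" where gen: "generic N E x" using generic_exists[OF finite_N inf] ..
  define \<T> where "\<T> = {T. card T = 3 \<and> T \<subseteq> N \<and> (\<forall>A\<in>G. \<not> T \<subseteq> A)}"
  have "finite \<T>" using finite_N by (intro finite_subset[of \<T> "Pow N"]) (auto simp: \<T>_def)
  then have "\<exists>y\<in>lifts x. \<forall>T\<in>\<T>. triangle x y T"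
    by (rule lift_triangle_all[OF inf gen]) (simp add: \<T>_def)
  then obtain y where y: "y \<in> lifts x" "\<forall>T\<in>\<T>. triangle x y T" by blast
  obtain a b where ab: "\<forall>A\<in>J. \<forall>i\<in>A. y i = x i * a A + b A" using y(1) by (auto simp: lifts_def)
  have E0: "\<forall>i\<in>E. x i = 0" using gen by (auto simp: generic_def admissible_def)
  have "area x y i j k = 0 \<longleftrightarrow> (\<exists>A\<in>G. {i, j, k} \<subseteq> A)"
    if ijk: "i \<in> N" "j \<in> N" "k \<in> N" "i \<noteq> j" "j \<noteq> k" "i \<noteq> k" for i j k
  proof
    assume "\<exists>A\<in>G. {i, j, k} \<subseteq> A"
    then obtain A where A: "A \<in> G" "i \<in> A" "j \<in> A" "k \<in> A" by auto
    show "area x y i j k = 0"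
    proof (cases "A = E")
      case True
      then show ?thesis using A E0 by (simp add: area_def)
    next
      case False
      then have "y i = x i * a A + b A" "y j = x j * a A + b A" "y k = x k * a A + b A"
        using A ab by auto
      then show ?thesis by (simp add: area_def algebra_simps)
    qed
  next
    assume 0: "area x y i j k = 0"
    show "\<exists>A\<in>G. {i, j, k} \<subseteq> A"
    proof (rule ccontr)
      assume "\<not> ?thesis"
      then have "{i, j, k} \<in> \<T>" using ijk by (simp add: \<T>_def)
      then obtain p q r where pqr: "{i, j, k} = {p, q, r}" "area x y p q r \<noteq> 0"
        using y(2) unfolding triangle_def by blast
      have "p \<in> {i, j, k}" "q \<in> {i, j, k}" "r \<in> {i, j, k}" using pqr(1) by simp_all
      then show False
        using pqr(2) 0 area_swap[of x y i j k] area_swap[of x y j k i] area_swap[of x y k i j] by auto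
    qed
  qed
  then show ?thesis by (intro exI[of _ x] exI[of _ y] ballI impI) assumption
qed

end

section \<open>Homogeneous coordinates and projective collinearity\<close>

definition affine_point :: "('a \<Rightarrow> 'k::field) \<Rightarrow> ('a \<Rightarrow> 'k) \<Rightarrow> 'a \<Rightarrow> 'k ^ 3" where
  "affine_point x y i = vector [x i, y i, 1]"

lemma affine_point_nth [simp]:
  "affine_point x y i $ 1 = x i" "affine_point x y i $ 2 = y i" "affine_point x y i $ 3 = 1"
  by (simp_all add: affine_point_def)

lemma affine_point_nonzero: "affine_point x y i \<noteq> 0"
  by (metis affine_point_nth(3) zero_index zero_neq_one)

lemma affine_point_in_span_singleton:
  assumes "affine_point x y i \<in> vec.span {affine_point x y j}"
  shows "affine_point x y i = affine_point x y j"
proof -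
  obtain c where c: "affine_point x y i = c *s affine_point x y j"
    using assms by (auto simp: vec.span_singleton)
  have "c = 1" using arg_cong[OF c, of "\<lambda>v. v $ 3"] by simp
  then show ?thesis using c by simp
qed

lemma dim_span_affine_points:
  assumes "affine_point x y i \<noteq> affine_point x y j"
  shows "vec.dim (vec.span {affine_point x y i, affine_point x y j}) = 2"
proof -
  have "vec.independent {affine_point x y i, affine_point x y j}"
    using assms affine_point_in_span_singleton[of x y i j] affine_point_nonzero[of x y j]
    by (auto simp: vec.independent_insert)
  then show ?thesis using assms by (simp add: vec.dim_eq_card_independent)
qed

text \<open>Comparing third coordinates shows that a linear combination of two points that is again
  of the form \<open>(x, y, 1)\<close> has coefficients with sum 1, so it is a point of the affine
  line through them.\<close>

lemma area_eq_0_iff_in_span: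
  fixes x y :: "'a \<Rightarrow> 'k::field"
  assumes "affine_point x y i \<noteq> affine_point x y j"
  shows "area x y i j k = 0 \<longleftrightarrow> affine_point x y k \<in> vec.span {affine_point x y i, affine_point x y j}"
proof
  assume "affine_point x y k \<in> vec.span {affine_point x y i, affine_point x y j}"
  then obtain s t where st: "affine_point x y k = s *s affine_point x y i + t *s affine_point x y j"
    by (auto simp: vec.span_insert vec.span_singleton algebra_simps)
  have "1 = s + t" using arg_cong[OF st, of "\<lambda>v. v $ 3"] by simp
  then have t: "t = 1 - s" by (simp add: algebra_simps)
  have xy: "x k = s * x i + t * x j" "y k = s * y i + t * y j"
    using arg_cong[OF st, of "\<lambda>v. v $ 1"] arg_cong[OF st, of "\<lambda>v. v $ 2"] by simp_all
  then show "area x y i j k = 0" unfolding area_def xy t by (simp add: algebra_simps)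
next
  assume 0: "area x y i j k = 0"
  have "\<not> (x i = x j \<and> y i = y j)" using assms by (auto simp: affine_point_def)
  then obtain t where t: "x k - x i = t * (x j - x i)" "y k - y i = t * (y j - y i)"
  proof (cases "x i = x j")
    case True
    then have "y j - y i \<noteq> 0" "x k = x i" using 0 \<open>\<not> (x i = x j \<and> y i = y j)\<close> by (auto simp: area_def)
    then show ?thesis using that[of "(y k - y i) / (y j - y i)"] True by simp
  next
    case False
    then show ?thesis using that[of "(x k - x i) / (x j - x i)"] 0
      by (simp add: area_def field_simps)
  qed
  have "affine_point x y k = (1 - t) *s affine_point x y i + t *s affine_point x y j"
    using t by (simp add: vec_eq_iff forall_3 algebra_simps)
  then show "affine_point x y k \<in> vec.span {affine_point x y i, affine_point x y j}"
    by (simp only:) (intro vec.span_add vec.span_scale vec.span_base; simp)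
qed

text \<open>Two distinct points of the family span the only projective line that can contain all of
  it.\<close>

lemma proj_collinear_iff:
  fixes x y :: "'a \<Rightarrow> 'k::field"
  assumes "affine_point x y i \<noteq> affine_point x y j" "i \<in> S" "j \<in> S"
  shows "proj_collinear ((\<lambda>i. vec.span {affine_point x y i}) ` S) \<longleftrightarrow> (\<forall>k\<in>S. area x y i j k = 0)"
proof
  let ?L = "vec.span {affine_point x y i, affine_point x y j}"
  assume "proj_collinear ((\<lambda>i. vec.span {affine_point x y i}) ` S)"
  then obtain L where L: "vec.subspace L" "vec.dim L = 2" "\<And>k. k \<in> S \<Longrightarrow> vec.span {affine_point x y k} \<subseteq> L"
    by (auto simp: proj_collinear_def proj_lines_def)
  then have mem: "affine_point x y k \<in> L" if "k \<in> S" for k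
    using that vec.span_base by blast
  have "?L \<subseteq> L" using mem assms L(1) by (intro vec.span_minimal) auto
  then have "?L = L"
    using L(1,2) dim_span_affine_points[OF assms(1)] by (intro vec.subspace_dim_equal) auto
  then show "\<forall>k\<in>S. area x y i j k = 0" using mem by (simp add: area_eq_0_iff_in_span[OF assms(1)])
next
  let ?L = "vec.span {affine_point x y i, affine_point x y j}"
  assume "\<forall>k\<in>S. area x y i j k = 0"
  then have "vec.span {affine_point x y k} \<subseteq> ?L" if "k \<in> S" for k
    using that by (intro vec.span_minimal) (auto simp: area_eq_0_iff_in_span[OF assms(1)])
  moreover have "?L \<in> proj_lines"
    using dim_span_affine_points[OF assms(1)] by (simp add: proj_lines_def)
  ultimately show "proj_collinear ((\<lambda>i. vec.span {affine_point x y i}) ` S)"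
    by (auto simp: proj_collinear_def)
qed

text \<open>Used to separate points: if \<open>i\<close> and \<open>j\<close> had the same image,
  every third point would be collinear with them. At most one edge contains both, and it is not all
  of \<open>N\<close>.\<close>

lemma (in irreducible_edges) exists_off_line:
  assumes "i \<in> N" "j \<in> N" "i \<noteq> j"
  shows "\<exists>k\<in>N. k \<noteq> i \<and> k \<noteq> j \<and> \<not> (\<exists>A\<in>G. {i, j, k} \<subseteq> A)"
proof -
  obtain A where A: "A \<in> G" "\<And>B. B \<in> G \<Longrightarrow> {i, j} \<subseteq> B \<Longrightarrow> B = A"
  proof (cases "\<exists>A\<in>G. {i, j} \<subseteq> A")
    case True
    then obtain A where A: "A \<in> G" "{i, j} \<subseteq> A" by blast
    have "B = A" if B: "B \<in> G" "{i, j} \<subseteq> B" for B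
    proof (rule ccontr)
      assume "B \<noteq> A"
      have "card {i, j} \<le> card (B \<inter> A)" using A B finite_edge by (intro card_mono) auto
      then show False using card_Int_edges[OF B(1) A(1) \<open>B \<noteq> A\<close>] assms(3) by simp
    qed
    then show thesis using that A(1) by blast
  next
    case False
    then show thesis using that E_edge by blast
  qed
  have "A \<noteq> N"
  proof
    assume "A = N"
    have "0 < card (G - {A})" using card_edges A(1) finite_G by simp
    then obtain B where B: "B \<in> G" "B \<noteq> A" by (auto simp: card_gt_0_iff)
    then have "A \<inter> B = B" using edge_subset \<open>A = N\<close> by blast
    then show False using card_Int_edges[of A B] A(1) B card_edge[of B] by auto
  qed
  then obtain k0 where k0: "k0 \<in> N" "k0 \<notin> A" using edge_subset[OF A(1)] by blast
  show ?thesis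
  proof (cases "k0 = i \<or> k0 = j")
    case False
    have "\<not> {i, j, k0} \<subseteq> B" if "B \<in> G" for B using A(2)[OF that] k0(2) by blast
    then show ?thesis using k0(1) False by blast
  next
    case True
    \<comment> \<open>A point of the pair lies outside \<open>A\<close>, the only edge that could
      contain both, so any third point will do.\<close>
    then have none: "\<not> {i, j, k} \<subseteq> B" if "B \<in> G" for B k using A(2)[OF that] k0(2) by blast
    have "3 \<le> card N" using card_edge[OF A(1)] card_mono[OF finite_N edge_subset[OF A(1)]] by simp
    then have "\<not> N \<subseteq> {i, j}" using card_mono[of "{i, j}" N] assms(3) by auto
    then show ?thesis using none by blast
  qed
qed

section \<open>From indexed hypertrees to sets of edges\<close>

text \<open>A repeated edge has at least 3 points and would violate strict convexity for the pair of
  its indices. Hence \<open>\<Gamma>\<close> is injective, and sums over indices become sums over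
  edges.\<close>

lemma irreducible_edges_image:
  fixes \<Gamma> :: "nat \<Rightarrow> 'a set"
  assumes irr: "irreducible_hypertree N d \<Gamma>" and "N \<noteq> {}"
  shows "irreducible_edges N (\<Gamma> ` {1..d}) (\<Gamma> 1)"
proof -
  have ht: "hypertree N d \<Gamma>" using irr by (simp add: irreducible_hypertree_def)
  have fN: "finite N" and sub: "\<And>j. j \<in> {1..d} \<Longrightarrow> \<Gamma> j \<subseteq> N"
    and card3: "\<And>j. j \<in> {1..d} \<Longrightarrow> 3 \<le> card (\<Gamma> j)"
    and deg: "\<And>i. i \<in> N \<Longrightarrow> 2 \<le> card {j\<in>{1..d}. i \<in> \<Gamma> j}"
    and norm: "int (card N) - 2 = (\<Sum>j=1..d. int (card (\<Gamma> j)) - 2)"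
    using ht unfolding hypertree_def by blast+
  have conv: "(\<Sum>j\<in>S. int (card (\<Gamma> j)) - 2) \<le> int (card (\<Union>j\<in>S. \<Gamma> j)) - 2"
    if "S \<noteq> {}" "S \<subseteq> {1..d}" for S
    using ht that unfolding hypertree_def by blast
  have strict: "(\<Sum>j\<in>S. int (card (\<Gamma> j)) - 2) < int (card (\<Union>j\<in>S. \<Gamma> j)) - 2"
    if "S \<subseteq> {1..d}" "1 < card S" "card S < d" for S
    using irr that unfolding irreducible_hypertree_def by blast
  obtain i0 where i0: "i0 \<in> N" using \<open>N \<noteq> {}\<close> by blast
  have "card {j\<in>{1..d}. i0 \<in> \<Gamma> j} \<le> card {1..d}" by (intro card_mono) auto
  then have "2 \<le> d" using deg[OF i0] by simp
  \<comment> \<open>With two edges, degree at least 2 puts every point on both, so both equal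
    \<open>N\<close>, and normalization would force \<open>|N| = 2\<close>.\<close>
  have "d \<noteq> 2"
  proof
    assume d: "d = 2"
    have all: "i \<in> \<Gamma> j" if "i \<in> N" "j \<in> {1..d}" for i j
    proof (rule ccontr)
      assume "i \<notin> \<Gamma> j"
      then have "card {j\<in>{1..d}. i \<in> \<Gamma> j} \<le> card ({1..d} - {j})" by (intro card_mono) auto
      then show False using deg[OF \<open>i \<in> N\<close>] that(2) d by simp
    qed
    have "\<Gamma> j = N" if "j \<in> {1..d}" for j using all sub that by blast
    then have "int (card N) - 2 = 2 * (int (card N) - 2)" "3 \<le> card N"
      using norm card3[of 1] d by simp_all
    then show False by simp
  qed
  then have d: "2 < d" using \<open>2 \<le> d\<close> by simp
  have inj: "inj_on \<Gamma> {1..d}"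
  proof (rule inj_onI, rule ccontr)
    fix j k assume jk: "j \<in> {1..d}" "k \<in> {1..d}" "\<Gamma> j = \<Gamma> k" "j \<noteq> k"
    then show False using strict[of "{j, k}"] d card3[of j] by simp
  qed
  have preimage: "\<exists>I. I \<subseteq> {1..d} \<and> S = \<Gamma> ` I \<and> card S = card I \<and>
      (\<Sum>A\<in>S. int (card A) - 2) = (\<Sum>j\<in>I. int (card (\<Gamma> j)) - 2)" if S: "S \<subseteq> \<Gamma> ` {1..d}" for S
  proof -
    obtain I where I: "I \<subseteq> {1..d}" "S = \<Gamma> ` I" using S by (meson subset_imageE)
    then have "inj_on \<Gamma> I" using inj inj_on_subset by blast
    then show ?thesis using I by (intro exI[of _ I]) (auto simp: card_image sum.reindex)
  qed
  have cG: "card (\<Gamma> ` {1..d}) = d" using inj by (simp add: card_image)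
  show ?thesis
  proof
    show "finite N" by (rule fN)
    show "A \<subseteq> N" if "A \<in> \<Gamma> ` {1..d}" for A using that sub by blast
    show "3 \<le> card A" if "A \<in> \<Gamma> ` {1..d}" for A using that card3 by blast
    show "2 \<le> card {A \<in> \<Gamma> ` {1..d}. i \<in> A}" if "i \<in> N" for i
    proof -
      have "{A \<in> \<Gamma> ` {1..d}. i \<in> A} = \<Gamma> ` {j\<in>{1..d}. i \<in> \<Gamma> j}" by blast
      moreover have "inj_on \<Gamma> {j\<in>{1..d}. i \<in> \<Gamma> j}" using inj by (rule inj_on_subset) blast
      ultimately show ?thesis using deg[OF that] by (simp add: card_image)
    qed
    show "(\<Sum>A\<in>S. int (card A) - 2) + 2 \<le> int (card (\<Union>S))" if "S \<subseteq> \<Gamma> ` {1..d}" "S \<noteq> {}" for S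
    proof -
      obtain I where I: "I \<subseteq> {1..d}" "S = \<Gamma> ` I"
          "(\<Sum>A\<in>S. int (card A) - 2) = (\<Sum>j\<in>I. int (card (\<Gamma> j)) - 2)"
        using preimage[OF \<open>S \<subseteq> \<Gamma> ` {1..d}\<close>] by blast
      then show ?thesis using conv[of I] that(2) by simp
    qed
    show "(\<Sum>A\<in>S. int (card A) - 2) + 3 \<le> int (card (\<Union>S))"
      if "S \<subseteq> \<Gamma> ` {1..d}" "1 < card S" "card S < card (\<Gamma> ` {1..d})" for S
    proof -
      obtain I where I: "I \<subseteq> {1..d}" "S = \<Gamma> ` I" "card S = card I"
          "(\<Sum>A\<in>S. int (card A) - 2) = (\<Sum>j\<in>I. int (card (\<Gamma> j)) - 2)"
        using preimage[OF \<open>S \<subseteq> \<Gamma> ` {1..d}\<close>] by blast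
      have "1 < card I" "card I < d" using that(2,3) I(3) cG by simp_all
      from strict[OF I(1) this] show ?thesis unfolding I(4) unfolding I(2) by simp
    qed
    show "int (card N) = (\<Sum>A\<in>\<Gamma> ` {1..d}. int (card A) - 2) + 2"
      unfolding sum.reindex[OF inj] comp_def using norm by simp
    show "\<Gamma> 1 \<in> \<Gamma> ` {1..d}" using d by simp
    show "2 < card (\<Gamma> ` {1..d})" using d cG by simp
  qed
qed

section \<open>The planar realization obtained from affine coordinates\<close>

theorem theorem6p1:
  fixes n d :: nat and \<Gamma> :: "nat \<Rightarrow> nat set"
  assumes "irreducible_hypertree {1..n} d \<Gamma>"
  shows "\<exists>p :: nat \<Rightarrow> ('k::alg_closed_field ^ 3) set. planar_realization {1..n} d \<Gamma> p"
proof -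
  have "hypertree {1..n} d \<Gamma>" using assms by (simp add: irreducible_hypertree_def)
  then have card3: "\<forall>j\<in>{1..d}. 3 \<le> card (\<Gamma> j)"
    and norm: "int (card {1..n}) - 2 = (\<Sum>j=1..d. int (card (\<Gamma> j)) - 2)"
    unfolding hypertree_def by blast+
  have "0 \<le> (\<Sum>j=1..d. int (card (\<Gamma> j)) - 2)"
    using card3 by (intro sum_nonneg) force
  then have "{1..n} \<noteq> {}" using norm by auto
  define G where "G = \<Gamma> ` {1..d}"
  interpret irreducible_edges "{1..n}" G "\<Gamma> 1"
    unfolding G_def by (rule irreducible_edges_image[OF assms \<open>{1..n} \<noteq> {}\<close>])
  from affine_realization[OF infinite_alg_closed_field]
  obtain x y :: "nat \<Rightarrow> 'k" where "\<forall>i\<in>{1..n}. \<forall>j\<in>{1..n}. \<forall>k\<in>{1..n}.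
      i \<noteq> j \<longrightarrow> j \<noteq> k \<longrightarrow> i \<noteq> k \<longrightarrow> (area x y i j k = 0 \<longleftrightarrow> (\<exists>A\<in>G. {i, j, k} \<subseteq> A))"
    by (elim exE)
  then have xy: "area x y i j k = 0 \<longleftrightarrow> (\<exists>A\<in>G. {i, j, k} \<subseteq> A)"
    if "i \<in> {1..n}" "j \<in> {1..n}" "k \<in> {1..n}" "i \<noteq> j" "j \<noteq> k" "i \<noteq> k" for i j k
    using that by blast
  have inj: "affine_point x y i \<noteq> affine_point x y j" if ij: "i \<in> {1..n}" "j \<in> {1..n}" "i \<noteq> j" for i j
  proof
    assume "affine_point x y i = affine_point x y j"
    then have "x i = x j" "y i = y j" by (metis affine_point_nth)+
    then have "area x y i j k = 0" for k by (simp add: area_def)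
    then show False using exists_off_line[OF ij] xy[OF ij(1,2) _ ij(3)] by metis
  qed
  define p where "p = (\<lambda>i. vec.span {affine_point x y i})"
  have "planar_realization {1..n} d \<Gamma> p"
    unfolding planar_realization_def
  proof (intro conjI ballI allI impI)
    show "p i \<in> proj_plane" for i
      using affine_point_nonzero[of x y i]
      by (simp add: p_def proj_plane_def vec.dim_eq_card_independent)
    show "inj_on p {1..n}"
    proof (rule inj_onI, rule ccontr)
      fix i j assume ij: "i \<in> {1..n}" "j \<in> {1..n}" "p i = p j" "i \<noteq> j"
      then have "affine_point x y i \<in> vec.span {affine_point x y j}"
        using vec.span_base[of "affine_point x y i" "{affine_point x y i}"] by (simp add: p_def)
      then show False using affine_point_in_span_singleton[of x y i j] inj[OF ij(1,2,4)] by simp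
    qed
    fix S assume S: "S \<subseteq> {1..n} \<and> 3 \<le> card S"
    then have "2 \<le> card S" by simp
    then obtain T where "T \<subseteq> S" "card T = 2" by (meson obtain_subset_with_card_n)
    then obtain i j where ij: "i \<in> S" "j \<in> S" "i \<noteq> j" by (auto simp: card_2_iff)
    then have N: "i \<in> {1..n}" "j \<in> {1..n}" using S by auto
    have "proj_collinear (p ` S) \<longleftrightarrow> (\<forall>k\<in>S. area x y i j k = 0)"
      unfolding p_def by (rule proj_collinear_iff[OF inj[OF N ij(3)] ij(1,2)])
    also have "\<dots> \<longleftrightarrow> (\<exists>A\<in>G. S \<subseteq> A)"
    proof
      assume 0: "\<forall>k\<in>S. area x y i j k = 0"
      have line: "\<exists>A\<in>G. {i, j, k} \<subseteq> A" if "k \<in> S" "k \<noteq> i" "k \<noteq> j" for k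
      proof -
        have "k \<in> {1..n}" using S that(1) by blast
        from xy[OF N this ij(3)] show ?thesis using 0 that by metis
      qed
      have "\<not> S \<subseteq> {i, j}"
      proof
        assume "S \<subseteq> {i, j}"
        then have "card S \<le> card {i, j}" by (intro card_mono) auto
        then show False using S ij(3) by simp
      qed
      then obtain k where k: "k \<in> S" "k \<noteq> i" "k \<noteq> j" by blast
      obtain A where A: "A \<in> G" "{i, j, k} \<subseteq> A" using line[OF k] by blast
      \<comment> \<open>The edges found for different points all contain \<open>i\<close> and
        \<open>j\<close>; since two distinct edges share at most one point, they coincide.\<close>
      have "l \<in> A" if l: "l \<in> S" for l
      proof (cases "l = i \<or> l = j")
        case False
        then obtain B where B: "B \<in> G" "{i, j, l} \<subseteq> B" using line[OF l] by blast
        have "A = B"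
        proof (rule ccontr)
          assume "A \<noteq> B"
          have "card {i, j} \<le> card (A \<inter> B)" using A B finite_edge by (intro card_mono) auto
          then show False using card_Int_edges[OF A(1) B(1) \<open>A \<noteq> B\<close>] ij(3) by simp
        qed
        then show ?thesis using B by simp
      qed (use A in auto)
      then show "\<exists>A\<in>G. S \<subseteq> A" using A(1) by blast
    next
      assume "\<exists>A\<in>G. S \<subseteq> A"
      then obtain A where A: "A \<in> G" "S \<subseteq> A" by blast
      have "area x y i j k = 0" if k: "k \<in> S" for k
      proof (cases "k = i \<or> k = j")
        case False
        have "{i, j, k} \<subseteq> A" using A(2) ij k by blast
        have "k \<in> {1..n}" using S k by blast
        from xy[OF N this ij(3)] show ?thesis using \<open>{i, j, k} \<subseteq> A\<close> False A(1) by metis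
      qed auto
      then show "\<forall>k\<in>S. area x y i j k = 0" by blast
    qed
    also have "\<dots> \<longleftrightarrow> (\<exists>j\<in>{1..d}. S \<subseteq> \<Gamma> j)" by (simp add: G_def)
    finally show "proj_collinear (p ` S) \<longleftrightarrow> (\<exists>j\<in>{1..d}. S \<subseteq> \<Gamma> j)" .
  qed
  then show ?thesis by blast
qed

end
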